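(* Let $1\le k\le N/2$, $L_0>0$, $\alpha\ge 1$, $\tau>0$, and let $n\ge 1$ be an integer. Let $\boldsymbol{A}\in\{0,1\}^{M\times N}$ be the adjacency matrix of $G_{k,N}$, a fixed $(k,1/16)$-expander with left set of size $N$, left degree $d=O(\log(N/k))$ and right set of size $M=O(k\log(N/k))$. For a rate vector $\boldsymbol{\lambda}^\star\in\mathbb{R}_+^N$ let $\boldsymbol{X}_n$ be the vector of values at time $n\tau$ of $N$ independent homogeneous Poisson processes with rates $\lambda^\star_1,\dots,\lambda^\star_N$, and let $\boldsymbol{Y}_n=\boldsymbol{A}\boldsymbol{X}_n$. Fix a small positive number $\delta$ such that $L_0/\sqrt\delta$ is an integer, and let $$\Lambda=\Big\{\boldsymbol{\lambda}\in\mathbb{R}_+^N:\ \|\boldsymbol{\lambda}\|_1\le L_0;\ \lambda_i\in\{m\sqrt\delta\}_{m=0}^{L_0/\sqrt\delta}\ \forall i\Big\},$$ with a penalty function $\mathrm{pen}(\boldsymbol{\lambda})\asymp\|\boldsymbol{\lambda}\|_0\log(\delta^{-1})$ defined so that it satisfies the Kraft inequality $\sum_{\boldsymbol{\lambda}\in\Lambda}e^{-\mathrm{pen}(\boldsymbol{\lambda})}\le 1$. Assume $\delta$ is small enough that (i) for any $\boldsymbol{\lambda}\in\Sigma_{\alpha,L_0}$ and any $1\le m\le N$ there is some $\boldsymbol{\lambda}^{(m)}\in\Lambda$ with $\|\boldsymbol{\lambda}^{(m)}\|_0\asymp m$ and $\|\boldsymbol{\lambda}-\boldsymbol{\lambda}^{(m)}\|_1^2\asymp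 m^{-2\alpha}+m\delta$, and (ii) the penalty term $\frac{m\log(\delta^{-1})}{n\tau}$ dominates the quantization error $m\delta$. Let $c=\frac{\gamma}{k\log(N/k)}$, where $\gamma>0$ is chosen so that $c\ll 1$, and let $\widehat{\boldsymbol{\lambda}}^{\mathrm{pMLE}}_n$ be the penalized maximum likelihood estimator built from $\boldsymbol{Y}_n,\Lambda,\mathrm{pen},c$ (defined in the context). Then $$\sup_{\boldsymbol{\lambda}^\star\in\Sigma_{\alpha,L_0}}\mathbb{E}_{\boldsymbol{\lambda}^\star}\big\|\widehat{\boldsymbol{\lambda}}^{\mathrm{pMLE}}_n-\boldsymbol{\lambda}^\star\big\|_1=O(k^{-\alpha})+\widetilde{O}\big(\sqrt{\gamma k}\big)+\widetilde{O}\left(\sqrt{\frac{k}{\gamma}}\left(\frac{\log(\delta^{-1})}{n\tau}\right)^{\frac{\alpha}{2\alpha+1}}\right),$$ where $\widetilde{O}(\cdot)$ hides factors that are logarithmic in $N$ and $k$.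
   Context: Heavy-tail class: $\Sigma_{\alpha,L_0}=\{\boldsymbol{\lambda}\in\mathbb{R}_+^N:\ \|\boldsymbol{\lambda}\|_1\le L_0;\ \sigma_m(\boldsymbol{\lambda})\le L_0m^{-\alpha}\ \text{for all } m\}$, where for $\boldsymbol{u}\in\mathbb{R}^N$ and $1\le m\le N$, $\sigma_m(\boldsymbol{u})=\sum_{i\notin S}|u_i|$ with $S$ the set of positions of the $m$ largest (in magnitude) coordinates of $\boldsymbol{u}$. $\|\boldsymbol{u}\|_0$ is the number of nonzero coordinates of $\boldsymbol{u}$. $a\asymp b$ means equality up to constant factors. Expander: a $(k,\varepsilon)$-expander is a bipartite simple graph $G=(A,B,E)$ with left degree $d$ (every vertex of $A$ has degree $d$), such that for any $S\subset A$ with $|S|\le k$, the set of neighbors $\mathcal{N}(S)\subset B$ satisfies $|\mathcal{N}(S)|\ge(1-\varepsilon)d|S|$. Its adjacency matrix is the $|B|\times|A|$ binary matrix whose $(j,i)$ entry is 1 iff $j\in B$ and $i\in A$ are adjacent. For any $1\le k\le N/2$ and $\varepsilon\in(0,1)$ there exists a $(k,\varepsilon)$-expander with left set size $N$, left degree $O(\log(N/k)/\varepsilon)$ and right set size $O(k\log(N/k)/\varepsilon^2)$; $G_{k,N}$ denotes a fixed such expander with $\varepsilon=1/16$. $\Omega\subset A=\{1,\dots,N\}$ denotes a minimal set of size $M$ whose neighborhood covers all of $B$, i.e. $\mathcal{N}(\Omega)=B$, and $\boldsymbol{I}_\Omega\in\{0,1\}^N$ is its indicator vector. Likelihood: for $\boldsymbol{\mu}\in\mathbb{R}_+^M$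 write $\mathbb{P}_{\boldsymbol{\mu}}(\boldsymbol{z})=\prod_{j=1}^M\mu_j^{z_j}e^{-\mu_j}/z_j!$ for $\boldsymbol{z}\in\mathbb{Z}_+^M$ (with the limiting convention $1_{\{z_j=0\}}$ when $\mu_j=0$). The law of the counter vector $\boldsymbol{Y}_n$ is taken to be $\mathbb{P}_{n\tau\boldsymbol{A}\boldsymbol{\lambda}^\star}$. Penalized MLE: put $\boldsymbol{\Phi}=\boldsymbol{A}/d$ and $L=n\tau dL_0$. Let $\Lambda_{n,\tau}=\{n\tau d\,\boldsymbol{\lambda}:\boldsymbol{\lambda}\in\Lambda\}$ with $\mathrm{pen}(n\tau d\,\boldsymbol{\lambda}):=\mathrm{pen}(\boldsymbol{\lambda})$, and $\mathcal{F}_c=\{\boldsymbol{f}=\boldsymbol{\theta}+cL\boldsymbol{I}_\Omega:\boldsymbol{\theta}\in\Lambda_{n,\tau}\}$ with $\mathrm{pen}(\boldsymbol{f}):=\mathrm{pen}(\boldsymbol{\theta})$. Then $$\widehat{\boldsymbol{f}}=\arg\min_{\boldsymbol{f}\in\mathcal{F}_c}\big[-\log\mathbb{P}_{\boldsymbol{\Phi}\boldsymbol{f}}(\boldsymbol{Y}_n)+2\,\mathrm{pen}(\boldsymbol{f})\big],\qquad\widehat{\boldsymbol{\theta}}=\widehat{\boldsymbol{f}}-cL\boldsymbol{I}_\Omega,\qquad\widehat{\boldsymbol{\lambda}}^{\mathrm{pMLE}}_n=\frac{\widehat{\boldsymbol{\theta}}}{n\tau d}.$$ *)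

theory Defs
  imports "HOL-Analysis.Analysis" "HOL-Probability.Probability"
begin

text \<open>
  The dimensions vary inside the statement, so a vector of length \<open>N\<close> is a function on \<open>nat\<close>
  that vanishes outside \<open>{..<N}\<close> (coordinates are numbered from 0), and an \<open>M \<times> N\<close> matrix is a
  function of a row index below \<open>M\<close> and a column index below \<open>N\<close>.
\<close>

definition nonneg_vecs :: "nat \<Rightarrow> (nat \<Rightarrow> real) set" where
  "nonneg_vecs N = {u. (\<forall>i. 0 \<le> u i) \<and> (\<forall>i\<ge>N. u i = 0)}"

definition norm1 :: "nat \<Rightarrow> (nat \<Rightarrow> real) \<Rightarrow> real" where
  "norm1 N u = (\<Sum>i<N. \<bar>u i\<bar>)"

definition norm0 :: "nat \<Rightarrow> (nat \<Rightarrow> real) \<Rightarrow> nat" where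
  "norm0 N u = card {i. i < N \<and> u i \<noteq> 0}"

definition mat_app :: "nat \<Rightarrow> (nat \<Rightarrow> nat \<Rightarrow> real) \<Rightarrow> (nat \<Rightarrow> real) \<Rightarrow> nat \<Rightarrow> real" where
  "mat_app N A u = (\<lambda>j. \<Sum>i<N. A j i * u i)"

text \<open>Equality up to constant factors, with the implied constant \<open>K\<close> made explicit.\<close>

definition eq_upto :: "real \<Rightarrow> real \<Rightarrow> real \<Rightarrow> bool" where
  "eq_upto K a b \<longleftrightarrow> a \<le> K * b \<and> b \<le> K * a"


subsection \<open>The heavy-tail class\<close>

definition top_positions :: "nat \<Rightarrow> (nat \<Rightarrow> real) \<Rightarrow> nat \<Rightarrow> nat set \<Rightarrow> bool" where
  "top_positions N u m S \<longleftrightarrow>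
     S \<subseteq> {..<N} \<and> card S = m \<and> (\<forall>i\<in>S. \<forall>j\<in>{..<N} - S. \<bar>u j\<bar> \<le> \<bar>u i\<bar>)"

text \<open>
  With ties there are several sets of \<open>m\<close> largest coordinates; they all give the same sum.
\<close>

definition best_approx_err :: "nat \<Rightarrow> nat \<Rightarrow> (nat \<Rightarrow> real) \<Rightarrow> real" where
  "best_approx_err N m u = (\<Sum>i\<in>{..<N} - (SOME S. top_positions N u m S). \<bar>u i\<bar>)"

lemma ex_top_positions: "m \<le> N \<Longrightarrow> \<exists>S. top_positions N u m S"
proof (induction m)
  case 0
  then show ?case by (intro exI[of _ "{}"]) (simp add: top_positions_def)
next
  case (Suc m)
  then obtain S where S: "S \<subseteq> {..<N}" "card S = m"
      "\<And>i j. i \<in> S \<Longrightarrow> j \<in> {..<N} - S \<Longrightarrow> \<bar>u j\<bar> \<le> \<bar>u i\<bar>"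
    unfolding top_positions_def by auto
  have fin: "finite S" using S(1) finite_subset by blast
  have "S \<noteq> {..<N}" using S(2) Suc.prems by auto
  then have ne: "{..<N} - S \<noteq> {}" using S(1) by auto
  define R where "R = (\<lambda>j. \<bar>u j\<bar>) ` ({..<N} - S)"
  have "Max R \<in> R" unfolding R_def using ne by (intro Max_in) auto
  then obtain p where p: "p \<in> {..<N} - S" "Max R = \<bar>u p\<bar>" unfolding R_def by auto
  have pmax: "\<bar>u j\<bar> \<le> \<bar>u p\<bar>" if "j \<in> {..<N} - S" for j
    unfolding p(2)[symmetric] using that by (intro Max_ge) (auto simp: R_def)
  have "top_positions N u (Suc m) (insert p S)"
    unfolding top_positions_def using S p(1) pmax fin by auto
  then show ?case by blast
qed

definition heavy_tail :: "nat \<Rightarrow> real \<Rightarrow> real \<Rightarrow> (nat \<Rightarrow> real) set" where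
  "heavy_tail N \<alpha> L0 = {l \<in> nonneg_vecs N. norm1 N l \<le> L0 \<and>
     (\<forall>m\<in>{1..N}. best_approx_err N m l \<le> L0 * real m powr (-\<alpha>))}"


subsection \<open>Expanders\<close>

text \<open>
  A bipartite simple graph with left set \<open>{..<N}\<close> and right set \<open>{..<M}\<close> is given by its edge
  set \<open>E\<close>; the neighborhood of \<open>S\<close> is the relational image \<open>E `` S\<close>.
\<close>

definition expander ::
  "nat \<Rightarrow> real \<Rightarrow> nat \<Rightarrow> nat \<Rightarrow> nat \<Rightarrow> (nat \<times> nat) set \<Rightarrow> bool" where
  "expander k \<epsilon> N M d E \<longleftrightarrow>
     E \<subseteq> {..<N} \<times> {..<M} \<and>
     (\<forall>i<N. card (E `` {i}) = d) \<and>
     (\<forall>S. S \<subseteq> {..<N} \<and> card S \<le> k \<longrightarrow>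
        (1 - \<epsilon>) * real d * real (card S) \<le> real (card (E `` S)))"

definition adj_matrix :: "(nat \<times> nat) set \<Rightarrow> nat \<Rightarrow> nat \<Rightarrow> real" where
  "adj_matrix E = (\<lambda>j i. if (i, j) \<in> E then 1 else 0)"

text \<open>
  Only the bound \<open>card \<Omega> \<le> M\<close> is imposed, not inclusion-minimality: this covers both the
  minimal covers, which automatically satisfy the bound (each vertex of a minimal cover has a
  private neighbor), and the covers with exactly \<open>M\<close> elements.
\<close>

definition covering_set :: "nat \<Rightarrow> nat \<Rightarrow> (nat \<times> nat) set \<Rightarrow> nat set \<Rightarrow> bool" where
  "covering_set N M E \<Omega> \<longleftrightarrow> \<Omega> \<subseteq> {..<N} \<and> card \<Omega> \<le> M \<and> E `` \<Omega> = {..<M}"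


subsection \<open>Poisson likelihood and the law of the counters\<close>

text \<open>Since \<open>0 ^ 0 = 1\<close>, a factor with \<open>\<mu> j = 0\<close> is the indicator of \<open>z j = 0\<close>.\<close>

definition poisson_lik :: "nat \<Rightarrow> (nat \<Rightarrow> real) \<Rightarrow> (nat \<Rightarrow> nat) \<Rightarrow> real" where
  "poisson_lik M \<mu> z = (\<Prod>j<M. \<mu> j ^ z j * exp (- \<mu> j) / fact (z j))"

text \<open>The library's \<open>poisson_pmf\<close> is specified for positive rates only.\<close>

definition poisson_law :: "nat \<Rightarrow> (nat \<Rightarrow> real) \<Rightarrow> (nat \<Rightarrow> nat) pmf" where
  "poisson_law M \<mu> =
     Pi_pmf {..<M} 0 (\<lambda>j. if \<mu> j = 0 then return_pmf 0 else poisson_pmf (\<mu> j))"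

lemma pmf_poisson_law:
  assumes "\<And>j. j < M \<Longrightarrow> 0 \<le> \<mu> j" and "\<And>j. M \<le> j \<Longrightarrow> z j = 0"
  shows "pmf (poisson_law M \<mu>) z = poisson_lik M \<mu> z"
proof -
  have "pmf (poisson_law M \<mu>) z =
      (\<Prod>j<M. pmf (if \<mu> j = 0 then return_pmf 0 else poisson_pmf (\<mu> j)) (z j))"
    unfolding poisson_law_def using assms(2) by (intro pmf_Pi') auto
  also have "\<dots> = poisson_lik M \<mu> z"
    unfolding poisson_lik_def
  proof (intro prod.cong refl)
    fix j assume "j \<in> {..<M}"
    then have "0 \<le> \<mu> j" using assms(1) by simp
    then show "pmf (if \<mu> j = 0 then return_pmf 0 else poisson_pmf (\<mu> j)) (z j) =
        \<mu> j ^ z j * exp (- \<mu> j) / fact (z j)"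
      by (cases "\<mu> j = 0") (auto simp: power_0_left)
  qed
  finally show ?thesis .
qed


subsection \<open>The penalized maximum likelihood estimator\<close>

definition quantized_class :: "nat \<Rightarrow> real \<Rightarrow> real \<Rightarrow> (nat \<Rightarrow> real) set" where
  "quantized_class N L0 \<delta> = {l \<in> nonneg_vecs N. norm1 N l \<le> L0 \<and>
     (\<forall>i<N. l i \<in> {real m * sqrt \<delta> | m::nat. real m \<le> L0 / sqrt \<delta>})}"

lemma finite_quantized_class: "finite (quantized_class N L0 \<delta>)"
proof -
  define V where "V = (\<lambda>m. real m * sqrt \<delta>) ` {m. real m \<le> L0 / sqrt \<delta>}"
  have "{m. real m \<le> L0 / sqrt \<delta>} \<subseteq> {..nat \<lfloor>L0 / sqrt \<delta>\<rfloor>}"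
    by (auto simp: le_nat_floor)
  then have "finite V" unfolding V_def using finite_subset by blast
  then have "finite {l. \<forall>i. (i \<in> {..<N} \<longrightarrow> l i \<in> V) \<and> (i \<notin> {..<N} \<longrightarrow> l i = 0)}"
    by (intro finite_set_of_finite_funs) auto
  then show ?thesis
    by (rule finite_subset[rotated])
       (auto simp: quantized_class_def nonneg_vecs_def V_def)
qed

text \<open>
  In the next two definitions \<open>s\<close> stands for \<open>n\<tau>d\<close> and \<open>b\<close> for \<open>cL\<close>. The second one transports
  the penalty from \<open>\<Lambda>\<close> to the class of shifted intensities.
\<close>

definition shifted_class ::
  "real \<Rightarrow> real \<Rightarrow> nat set \<Rightarrow> (nat \<Rightarrow> real) set \<Rightarrow> (nat \<Rightarrow> real) set" where
  "shifted_class s b \<Omega> \<Lambda> = {\<lambda>i. s * l i + b * indicator \<Omega> i | l. l \<in> \<Lambda>}"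

definition unshift :: "real \<Rightarrow> real \<Rightarrow> nat set \<Rightarrow> (nat \<Rightarrow> real) \<Rightarrow> nat \<Rightarrow> real" where
  "unshift s b \<Omega> f = (\<lambda>i. (f i - b * indicator \<Omega> i) / s)"

text \<open>
  \<open>est\<close> is a penalized MLE if its value at every observation \<open>y\<close> comes from a minimizer; ties
  may be broken arbitrarily. All likelihoods that occur are positive when \<open>b > 0\<close> and \<open>\<Omega>\<close> is a
  covering set, so the convention for \<open>ln 0\<close> plays no role.
\<close>

definition is_pmle ::
  "nat \<Rightarrow> nat \<Rightarrow> nat \<Rightarrow> (nat \<times> nat) set \<Rightarrow> nat set \<Rightarrow> nat \<Rightarrow> real \<Rightarrow> real \<Rightarrow> real \<Rightarrow>
   (nat \<Rightarrow> real) set \<Rightarrow> ((nat \<Rightarrow> real) \<Rightarrow> real) \<Rightarrow> ((nat \<Rightarrow> nat) \<Rightarrow> nat \<Rightarrow> real) \<Rightarrow> bool" where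
  "is_pmle N M d E \<Omega> n \<tau> L0 c \<Lambda> pen est \<longleftrightarrow>
     (let \<Phi> = (\<lambda>j i. adj_matrix E j i / real d);
          s = real n * \<tau> * real d;
          L = s * L0
      in \<forall>y. \<exists>f. is_arg_min
               (\<lambda>f. - ln (poisson_lik M (mat_app N \<Phi> f) y) + 2 * pen (unshift s (c * L) \<Omega> f))
               (\<lambda>f. f \<in> shifted_class s (c * L) \<Omega> \<Lambda>) f \<and>
             est y = unshift s (c * L) \<Omega> f)"

end

theory Submission
  imports Defs
begin

text \<open>
  The expander property controls \<open>\<parallel>\<lambda>' - \<lambda>\<parallel>\<^sub>1\<close> for nonnegative vectors by \<open>\<parallel>\<Phi> (\<lambda>' - \<lambda>)\<parallel>\<^sub>1\<close> and the tail
  of \<open>\<lambda>\<close> beyond about \<open>k / 2\<close> coordinates. The measurement error is bounded through the Hellinger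
  distance of the Poisson laws, and the Li--Barron argument bounds the expected Hellinger loss of
  the penalized estimator by the Kullback--Leibler divergence from the truth to any candidate
  plus twice its penalty. The shift \<open>cL I\<^sub>\<Omega>\<close> keeps all candidate intensities above \<open>cL / d\<close>, so this
  divergence is at most a chi-square distance of order \<open>\<parallel>\<Phi> (\<lambda>' - \<lambda>)\<parallel>\<^sub>2\<^sup>2 / c + cM\<close>.

  The candidate is a rounding of the \<open>m\<close> largest coordinates of the truth, with
  \<open>m = min N \<lceil>\<rho> powr (- 1 / (2\<alpha> + 1))\<rceil>\<close> and \<open>\<rho> = log (1 / \<delta>) / (n\<tau>)\<close>. For \<open>m = N\<close> an \<open>\<ell>\<^sub>1\<close> error of order
  \<open>N powr (- \<alpha>)\<close> would be too large. Dependent rounding gives instead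
  \<open>\<parallel>\<Phi> (\<lambda>' - \<lambda>)\<parallel>\<^sub>2\<^sup>2 = O(\<sigma>\<^sub>m(\<lambda>)\<^sup>2 + m\<delta>) / d\<close>, where the tail vanishes for \<open>m = N\<close>.
\<close>

subsection \<open>Expanders and nonnegative vectors\<close>

text \<open>By exchange: \<open>S - T\<close> and \<open>T - S\<close> have the same size, and every
  magnitude on \<open>S - T\<close> is at most every magnitude on \<open>T - S\<close>.\<close>

lemma sum_top_positions_ge:
  assumes T: "top_positions N u m T" and S: "S \<subseteq> {..<N}" "card S = m"
  shows "(\<Sum>i\<in>S. \<bar>u i\<bar>) \<le> (\<Sum>i\<in>T. \<bar>u i\<bar>)"
proof -
  have T': "T \<subseteq> {..<N}" "card T = m" "\<And>i j. i \<in> T \<Longrightarrow> j \<in> {..<N} - T \<Longrightarrow> \<bar>u j\<bar> \<le> \<bar>u i\<bar>"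
    using T unfolding top_positions_def by auto
  have fin: "finite S" "finite T" using S T' finite_subset by blast+
  have card: "card (S - T) = card (T - S)"
    using card_le_sym_Diff[of S T] card_le_sym_Diff[of T S] S T' fin by simp
  obtain b where b: "bij_betw b (S - T) (T - S)"
    using fin card by (meson finite_Diff finite_same_card_bij)
  have "(\<Sum>i\<in>S - T. \<bar>u i\<bar>) \<le> (\<Sum>i\<in>S - T. \<bar>u (b i)\<bar>)"
    by (intro sum_mono T'(3)) (use b S in \<open>auto simp: bij_betw_def\<close>)
  also have "\<dots> = (\<Sum>i\<in>T - S. \<bar>u i\<bar>)"
    by (rule sum.reindex_bij_betw[OF b])
  finally have "(\<Sum>i\<in>S - T. \<bar>u i\<bar>) \<le> (\<Sum>i\<in>T - S. \<bar>u i\<bar>)" .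
  moreover have "(\<Sum>i\<in>S. \<bar>u i\<bar>) = (\<Sum>i\<in>S \<inter> T. \<bar>u i\<bar>) + (\<Sum>i\<in>S - T. \<bar>u i\<bar>)"
    using fin by (subst sum.Int_Diff[of S _ T]) auto
  moreover have "(\<Sum>i\<in>T. \<bar>u i\<bar>) = (\<Sum>i\<in>S \<inter> T. \<bar>u i\<bar>) + (\<Sum>i\<in>T - S. \<bar>u i\<bar>)"
    using fin by (subst sum.Int_Diff[of T _ S]) (auto simp: Int_commute)
  ultimately show ?thesis by simp
qed

text \<open>Replaces the choice operator in \<open>best_approx_err\<close> by a named set, so that
  the tail sum can be split along it.\<close>

lemma best_approx_err_positions:
  assumes "m \<le> N"
  obtains S where "S \<subseteq> {..<N}" "card S = m" "best_approx_err N m u = (\<Sum>i\<in>{..<N} - S. \<bar>u i\<bar>)"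
proof -
  define S where "S = (SOME S. top_positions N u m S)"
  have "top_positions N u m S"
    unfolding S_def using ex_top_positions[OF assms] by (rule someI_ex)
  then show ?thesis
    using that[of S] unfolding best_approx_err_def S_def[symmetric] top_positions_def by auto
qed

text \<open>
  A discrete layer cake: expansion of all subsets of \<open>T\<close> selects for each neighbor \<open>j\<close> of \<open>T\<close>
  one adjacent vertex \<open>g j\<close>, so that few edges carry the weight that is not selected.
\<close>

lemma expansion_selection:
  fixes w :: "'a \<Rightarrow> real" and \<beta> :: real
  assumes "finite T" "finite (E `` T)"
    and "\<And>S. S \<subseteq> T \<Longrightarrow> \<beta> * real (card S) \<le> real (card (E `` S))"
    and "\<And>i. i \<in> T \<Longrightarrow> 0 \<le> w i"
  shows "\<exists>g. (\<forall>j\<in>E `` T. g j \<in> T \<and> (g j, j) \<in> E) \<and> \<beta> * (\<Sum>i\<in>T. w i) \<le> (\<Sum>j\<in>E `` T. w (g j))"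
  using assms
proof (induction "card T" arbitrary: T w)
  case 0
  then have "T = {}" by simp
  then show ?case by simp
next
  case (Suc n)
  then have "T \<noteq> {}" by auto
  define m where "m = Min (w ` T)"
  have "m \<in> w ` T" unfolding m_def using Suc.prems \<open>T \<noteq> {}\<close> by (intro Min_in) auto
  then obtain p where p: "p \<in> T" "w p = m" by auto
  have m_le: "m \<le> w i" if "i \<in> T" for i
    unfolding m_def using Suc.prems that by (intro Min_le) auto
  have "m \<ge> 0" using p Suc.prems by auto
  define T' where "T' = T - {p}"
  define w' where "w' i = w i - m" for i
  have sub: "E `` T' \<subseteq> E `` T" unfolding T'_def by auto
  have fin': "finite (E `` T')" using sub Suc.prems(2) finite_subset by blast
  have "\<exists>g. (\<forall>j\<in>E `` T'. g j \<in> T' \<and> (g j, j) \<in> E) \<and> \<beta> * sum w' T' \<le> (\<Sum>j\<in>E `` T'. w' (g j))"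
  proof (rule Suc.hyps(1))
    show "n = card T'" using Suc.hyps(2) Suc.prems p unfolding T'_def by simp
    show "finite T'" using Suc.prems unfolding T'_def by simp
    show "finite (E `` T')" by (rule fin')
    show "\<beta> * real (card S) \<le> real (card (E `` S))" if "S \<subseteq> T'" for S
      using that Suc.prems(3)[of S] unfolding T'_def by blast
    show "0 \<le> w' i" if "i \<in> T'" for i
      using that m_le[of i] unfolding w'_def T'_def by auto
  qed
  then obtain g where g: "\<And>j. j \<in> E `` T' \<Longrightarrow> g j \<in> T' \<and> (g j, j) \<in> E"
      "\<beta> * sum w' T' \<le> (\<Sum>j\<in>E `` T'. w' (g j))" by auto
  define g' where "g' j = (if j \<in> E `` T' then g j else p)" for j
  have "g' j \<in> T \<and> (g' j, j) \<in> E" if "j \<in> E `` T" for j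
    using g(1)[of j] that p unfolding g'_def T'_def by auto
  moreover have "\<beta> * sum w T \<le> (\<Sum>j\<in>E `` T. w (g' j))"
  proof -
    have "sum w T = (\<Sum>i\<in>T. w' i) + m * card T"
      by (simp add: w'_def sum_subtractf)
    also have "(\<Sum>i\<in>T. w' i) = (\<Sum>i\<in>T'. w' i)"
      unfolding T'_def using Suc.prems(1) p by (subst sum.remove[of T p]) (auto simp: w'_def)
    finally have "\<beta> * sum w T = \<beta> * sum w' T' + m * (\<beta> * card T)" by (simp add: algebra_simps)
    also have "\<dots> \<le> (\<Sum>j\<in>E `` T'. w' (g j)) + m * card (E `` T)"
      using g(2) Suc.prems(3)[of T] \<open>m \<ge> 0\<close> by (intro add_mono mult_left_mono) auto
    also have "(\<Sum>j\<in>E `` T'. w' (g j)) = (\<Sum>j\<in>E `` T. w' (g' j))"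
      using sub Suc.prems(2) p by (intro sum.mono_neutral_cong_left) (auto simp: g'_def w'_def)
    also have "\<dots> + m * card (E `` T) = (\<Sum>j\<in>E `` T. w (g' j))"
      by (simp add: w'_def sum_subtractf)
    finally show ?thesis .
  qed
  ultimately show ?case by blast
qed

locale expander_graph =
  fixes k :: nat and \<epsilon> :: real and N M d :: nat and E :: "(nat \<times> nat) set"
  assumes expander: "expander k \<epsilon> N M d E" and d_pos: "d \<ge> 1"
begin

definition \<Phi> :: "nat \<Rightarrow> nat \<Rightarrow> real" where
  "\<Phi> j i = adj_matrix E j i / real d"

lemma edge_bounds: "(i, j) \<in> E \<Longrightarrow> i < N \<and> j < M"
  using expander unfolding expander_def by auto

lemma card_nbhd: "i < N \<Longrightarrow> card (E `` {i}) = d"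
  using expander unfolding expander_def by auto

lemma expansion: "S \<subseteq> {..<N} \<Longrightarrow> card S \<le> k \<Longrightarrow> (1 - \<epsilon>) * real d * real (card S) \<le> real (card (E `` S))"
  using expander unfolding expander_def by auto

lemma finite_nbhd: "finite (E `` S)"
  by (rule finite_subset[of _ "{..<M}"]) (use edge_bounds in auto)

lemma \<Phi>_nonneg: "0 \<le> \<Phi> j i"
  by (simp add: \<Phi>_def adj_matrix_def)

lemma sum_adj: "X \<subseteq> {..<M} \<Longrightarrow> (\<Sum>j\<in>X. adj_matrix E j i) = real (card (E `` {i} \<inter> X))"
proof -
  assume X: "X \<subseteq> {..<M}"
  then have fin: "finite X" using finite_subset by blast
  have "(\<Sum>j\<in>X. adj_matrix E j i) = real (card {j \<in> X. (i, j) \<in> E})"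
    using fin by (simp add: adj_matrix_def sum.If_cases Int_def conj_commute)
  also have "{j \<in> X. (i, j) \<in> E} = E `` {i} \<inter> X" by auto
  finally show ?thesis .
qed

lemma sum_\<Phi>_column: "i < N \<Longrightarrow> (\<Sum>j<M. \<Phi> j i) = 1"
proof -
  assume i: "i < N"
  have "E `` {i} \<inter> {..<M} = E `` {i}" using edge_bounds by auto
  then show ?thesis
    using sum_adj[of "{..<M}" i] card_nbhd[OF i] d_pos by (simp add: \<Phi>_def flip: sum_divide_distrib)
qed

text \<open>The entries are 0 or \<open>1 / d\<close>, so squaring divides a column sum by
  \<open>d\<close>. This factor later cancels the \<open>d\<close> lost in the lower bound
  \<open>shift / d\<close> on the intensities.\<close>

lemma sum_\<Phi>_column_square: "i < N \<Longrightarrow> (\<Sum>j<M. (\<Phi> j i)\<^sup>2) = 1 / real d"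
proof -
  assume i: "i < N"
  have "(\<Sum>j<M. (\<Phi> j i)\<^sup>2) = (\<Sum>j<M. \<Phi> j i / real d)"
    by (intro sum.cong) (auto simp: \<Phi>_def adj_matrix_def power2_eq_square)
  then show ?thesis using sum_\<Phi>_column[OF i] by (simp flip: sum_divide_distrib)
qed

lemma sum_mat_app_\<Phi>: "(\<Sum>j<M. mat_app N \<Phi> u j) = (\<Sum>i<N. u i)"
proof -
  have "(\<Sum>j<M. mat_app N \<Phi> u j) = (\<Sum>i<N. (\<Sum>j<M. \<Phi> j i) * u i)"
    unfolding mat_app_def by (subst sum.swap) (simp add: sum_distrib_right)
  also have "\<dots> = (\<Sum>i<N. u i)"
    by (intro sum.cong) (auto simp: sum_\<Phi>_column)
  finally show ?thesis .
qed

text \<open>Of the \<open>d\<close> edges at a vertex of \<open>Q\<close>, those that end in the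
  neighborhood of \<open>T\<close> yield no new neighbor. Expansion of \<open>T \<union> Q\<close>
  leaves room for at most a fraction \<epsilon> of such collisions.\<close>

lemma sum_edges_into_nbhd:
  assumes T: "T \<subseteq> {..<N}" and Q: "Q \<subseteq> {..<N}" "Q \<inter> T = {}" "card (T \<union> Q) \<le> k"
  shows "(\<Sum>i\<in>Q. real (card (E `` {i} \<inter> E `` T))) \<le> \<epsilon> * real d * real (card (T \<union> Q))"
proof -
  have fin: "finite T" "finite Q" using T Q finite_subset by blast+
  have nb: "E `` (T \<union> Q) = E `` T \<union> (\<Union>i\<in>Q. E `` {i} - E `` T)" by auto
  have "real (card (E `` T)) \<le> real d * real (card T)"
  proof -
    have "card (E `` T) = card (\<Union>i\<in>T. E `` {i})" by (rule arg_cong[of _ _ card]) auto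
    also have "\<dots> \<le> (\<Sum>i\<in>T. card (E `` {i}))" by (rule card_UN_le[OF fin(1)])
    also have "\<dots> = (\<Sum>i\<in>T. d)" using T card_nbhd by (intro sum.cong) auto
    finally have "card (E `` T) \<le> d * card T" by (simp add: mult.commute)
    then show ?thesis by (metis of_nat_le_iff of_nat_mult)
  qed
  moreover have "real (card (\<Union>i\<in>Q. E `` {i} - E `` T)) \<le> real d * real (card Q) - (\<Sum>i\<in>Q. real (card (E `` {i} \<inter> E `` T)))"
  proof -
    have "real (card (\<Union>i\<in>Q. E `` {i} - E `` T)) \<le> (\<Sum>i\<in>Q. real (card (E `` {i} - E `` T)))"
      using card_UN_le[OF fin(2), of "\<lambda>i. E `` {i} - E `` T"] by (metis of_nat_le_iff of_nat_sum)
    also have "\<dots> = (\<Sum>i\<in>Q. real d - real (card (E `` {i} \<inter> E `` T)))"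
    proof (intro sum.cong refl)
      fix i assume "i \<in> Q"
      then have "i < N" using Q by auto
      have "card (E `` {i}) = card (E `` {i} \<inter> E `` T) + card (E `` {i} - E `` T)"
        using finite_nbhd[of "{i}"] by (metis card_Int_Diff)
      then show "real (card (E `` {i} - E `` T)) = real d - real (card (E `` {i} \<inter> E `` T))"
        using card_nbhd[OF \<open>i < N\<close>] by simp
    qed
    finally show ?thesis by (simp add: sum_subtractf mult.commute)
  qed
  moreover have "card (E `` (T \<union> Q)) \<le> card (E `` T) + card (\<Union>i\<in>Q. E `` {i} - E `` T)"
    unfolding nb by (rule card_Un_le)
  moreover have "(1 - \<epsilon>) * real d * real (card (T \<union> Q)) \<le> real (card (E `` (T \<union> Q)))"
    using T Q by (intro expansion) auto
  moreover have "card (T \<union> Q) = card T + card Q"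
    using fin Q by (intro card_Un_disjoint) auto
  ultimately have "(1 - \<epsilon>) * real d * real (card (T \<union> Q)) \<le> real d * real (card T) + real d * real (card Q) - (\<Sum>i\<in>Q. real (card (E `` {i} \<inter> E `` T)))"
    by linarith
  then show ?thesis using \<open>card (T \<union> Q) = card T + card Q\<close> by (simp add: algebra_simps)
qed

text \<open>
  Fewer than \<open>m\<close> vertices send more than \<open>2\<epsilon>d\<close> edges into the neighborhood of \<open>T\<close>, and their
  coordinates do not exceed the average over \<open>T\<close>. This replaces the usual decomposition of
  the complement of \<open>T\<close> into blocks of decreasing magnitude.
\<close>

lemma tail_collisions:
  assumes T: "top_positions N h m T" and m: "1 \<le> m" "2 * m \<le> k"
  shows "(\<Sum>i\<in>{..<N} - T. \<bar>h i\<bar> * real (card (E `` {i} \<inter> E `` T))) \<le> 2 * \<epsilon> * real d * norm1 N h"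
proof -
  define e where "e i = real (card (E `` {i} \<inter> E `` T))" for i
  have T': "T \<subseteq> {..<N}" "card T = m" "\<And>i j. i \<in> T \<Longrightarrow> j \<in> {..<N} - T \<Longrightarrow> \<bar>h j\<bar> \<le> \<bar>h i\<bar>"
    using T unfolding top_positions_def by auto
  have finT: "finite T" using T' finite_subset by blast
  have few: "(\<Sum>i\<in>Q. e i) \<le> 2 * \<epsilon> * real d * real m" if Q: "Q \<subseteq> {..<N} - T" "card Q \<le> m" "\<epsilon> \<ge> 0" for Q
  proof -
    have "finite Q" using Q finite_subset by blast
    then have c: "card (T \<union> Q) = m + card Q" using Q T' finT by (subst card_Un_disjoint) auto
    have "(\<Sum>i\<in>Q. e i) \<le> \<epsilon> * real d * real (card (T \<union> Q))"
      unfolding e_def using Q T' m c by (intro sum_edges_into_nbhd) auto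
    also have "\<dots> \<le> \<epsilon> * real d * real (2 * m)"
      using Q by (intro mult_left_mono) (auto simp: c)
    finally show ?thesis by simp
  qed
  \<comment> \<open>With \<open>Q\<close> empty the collision bound reads
    \<open>0 \<le> \<epsilon> * d * m\<close>.\<close>
  have \<epsilon>: "\<epsilon> \<ge> 0"
  proof -
    have "(\<Sum>i\<in>{}. real (card (E `` {i} \<inter> E `` T))) \<le> \<epsilon> * real d * real (card (T \<union> {}))"
      using T' m by (intro sum_edges_into_nbhd) auto
    then show ?thesis using d_pos m T' by (simp add: zero_le_mult_iff)
  qed
  define B where "B = {i \<in> {..<N} - T. e i > 2 * \<epsilon> * real d}"
  have finB: "finite B" unfolding B_def by auto
  have "card B < m"
  proof (rule ccontr)
    assume "\<not> card B < m"
    then obtain Q where Q: "Q \<subseteq> B" "card Q = m" by (meson not_less obtain_subset_with_card_n)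
    have "finite Q" "Q \<noteq> {}" using Q finB finite_subset m by auto
    then have "(\<Sum>i\<in>Q. 2 * \<epsilon> * real d) < (\<Sum>i\<in>Q. e i)"
      using Q by (intro sum_strict_mono) (auto simp: B_def)
    moreover have "(\<Sum>i\<in>Q. e i) \<le> 2 * \<epsilon> * real d * real m"
      using Q \<epsilon> by (intro few) (auto simp: B_def)
    ultimately show False using Q by (simp add: mult.commute)
  qed
  \<comment> \<open>The average magnitude over \<open>T\<close> dominates each coordinate outside
    \<open>T\<close>, so the collisions of the exceptional set \<open>B\<close> are charged to the
    mass on \<open>T\<close>.\<close>
  define a where "a = (\<Sum>i\<in>T. \<bar>h i\<bar>) / real m"
  have le_a: "\<bar>h j\<bar> \<le> a" if "j \<in> {..<N} - T" for j
  proof -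
    have "real (card T) * \<bar>h j\<bar> \<le> (\<Sum>i\<in>T. \<bar>h i\<bar>)"
      using T'(3) that by (intro sum_bounded_below) auto
    then show ?thesis unfolding a_def using m T' by (simp add: field_simps)
  qed
  have "(\<Sum>i\<in>B. \<bar>h i\<bar> * e i) \<le> (\<Sum>i\<in>B. a * e i)"
    using le_a by (intro sum_mono mult_right_mono) (auto simp: B_def e_def)
  also have "\<dots> = a * (\<Sum>i\<in>B. e i)" by (simp add: sum_distrib_left)
  also have "\<dots> \<le> a * (2 * \<epsilon> * real d * real m)"
    using \<open>card B < m\<close> \<epsilon> by (intro mult_left_mono few) (auto simp: B_def a_def sum_nonneg)
  also have "\<dots> = 2 * \<epsilon> * real d * (\<Sum>i\<in>T. \<bar>h i\<bar>)"
    unfolding a_def using m by simp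
  finally have 1: "(\<Sum>i\<in>B. \<bar>h i\<bar> * e i) \<le> 2 * \<epsilon> * real d * (\<Sum>i\<in>T. \<bar>h i\<bar>)" .
  have "(\<Sum>i\<in>({..<N} - T) - B. \<bar>h i\<bar> * e i) \<le> (\<Sum>i\<in>({..<N} - T) - B. \<bar>h i\<bar> * (2 * \<epsilon> * real d))"
    by (intro sum_mono mult_left_mono) (auto simp: B_def)
  also have "\<dots> \<le> (\<Sum>i\<in>{..<N} - T. \<bar>h i\<bar> * (2 * \<epsilon> * real d))"
    using \<epsilon> by (intro sum_mono2) auto
  also have "\<dots> = 2 * \<epsilon> * real d * (\<Sum>i\<in>{..<N} - T. \<bar>h i\<bar>)"
    by (simp add: sum_distrib_left mult_ac)
  finally have 2: "(\<Sum>i\<in>({..<N} - T) - B. \<bar>h i\<bar> * e i) \<le> 2 * \<epsilon> * real d * (\<Sum>i\<in>{..<N} - T. \<bar>h i\<bar>)" .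
  have "(\<Sum>i\<in>{..<N} - T. \<bar>h i\<bar> * e i) = (\<Sum>i\<in>({..<N} - T) - B. \<bar>h i\<bar> * e i) + (\<Sum>i\<in>B. \<bar>h i\<bar> * e i)"
    by (intro sum.subset_diff) (auto simp: B_def)
  also have "\<dots> \<le> 2 * \<epsilon> * real d * ((\<Sum>i\<in>{..<N} - T. \<bar>h i\<bar>) + (\<Sum>i\<in>T. \<bar>h i\<bar>))"
    using 1 2 by (simp add: algebra_simps)
  also have "(\<Sum>i\<in>{..<N} - T. \<bar>h i\<bar>) + (\<Sum>i\<in>T. \<bar>h i\<bar>) = norm1 N h"
    unfolding norm1_def using T' by (subst sum.subset_diff[of T "{..<N}"]) auto
  finally show ?thesis unfolding e_def .
qed

text \<open>In each row met by \<open>T\<close> the selected vertex competes with all other entries.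
  The selected edges carry at least \<open>(1 - \<epsilon>) * d\<close> times the mass on
  \<open>T\<close>, while the edges from \<open>T\<close> carry \<open>d\<close> times it and the
  edges from outside are bounded by \<open>tail_collisions\<close>. The factor
  \<open>1 - 2 * \<epsilon>\<close> is \<open>2 * (1 - \<epsilon>) - 1\<close>.\<close>

lemma top_positions_norm_le:
  assumes T: "top_positions N h m T" and m: "1 \<le> m" "2 * m \<le> k"
  shows "(1 - 2 * \<epsilon>) * (\<Sum>i\<in>T. \<bar>h i\<bar>) \<le> norm1 M (mat_app N \<Phi> h) + 2 * \<epsilon> * norm1 N h"
proof -
  have T': "T \<subseteq> {..<N}" "card T = m"
    using T unfolding top_positions_def by auto
  have finT: "finite T" using T' finite_subset by blast
  define e where "e i = real (card (E `` {i} \<inter> E `` T))" for i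
  have "\<exists>g. (\<forall>j\<in>E `` T. g j \<in> T \<and> (g j, j) \<in> E) \<and>
      (1 - \<epsilon>) * real d * (\<Sum>i\<in>T. \<bar>h i\<bar>) \<le> (\<Sum>j\<in>E `` T. \<bar>h (g j)\<bar>)"
  proof (rule expansion_selection[OF finT finite_nbhd])
    fix S assume "S \<subseteq> T"
    then have "card S \<le> m" using T' finT card_mono by blast
    then show "(1 - \<epsilon>) * real d * real (card S) \<le> real (card (E `` S))"
      using \<open>S \<subseteq> T\<close> T' m by (intro expansion) auto
  qed auto
  then obtain g where g: "\<And>j. j \<in> E `` T \<Longrightarrow> g j \<in> T \<and> (g j, j) \<in> E"
      "(1 - \<epsilon>) * real d * (\<Sum>i\<in>T. \<bar>h i\<bar>) \<le> (\<Sum>j\<in>E `` T. \<bar>h (g j)\<bar>)" by auto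
  have sub: "E `` T \<subseteq> {..<M}" using edge_bounds by auto
  \<comment> \<open>The reverse triangle inequality. The coefficient 2 appears because the
    subtracted sum contains the selected entry as well.\<close>
  have point: "2 * \<bar>h (g j)\<bar> - (\<Sum>i<N. adj_matrix E j i * \<bar>h i\<bar>) \<le> \<bar>\<Sum>i<N. adj_matrix E j i * h i\<bar>"
    if j: "j \<in> E `` T" for j
  proof -
    have gj: "g j \<in> {..<N}" "adj_matrix E j (g j) = 1" using g(1)[OF j] T' by (auto simp: adj_matrix_def)
    define r where "r = (\<Sum>i\<in>{..<N} - {g j}. adj_matrix E j i * h i)"
    have "\<bar>r\<bar> \<le> (\<Sum>i\<in>{..<N} - {g j}. \<bar>adj_matrix E j i * h i\<bar>)"
      unfolding r_def by (rule sum_abs)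
    also have "\<dots> = (\<Sum>i\<in>{..<N} - {g j}. adj_matrix E j i * \<bar>h i\<bar>)"
      by (intro sum.cong) (auto simp: adj_matrix_def)
    finally have r: "\<bar>r\<bar> \<le> (\<Sum>i\<in>{..<N} - {g j}. adj_matrix E j i * \<bar>h i\<bar>)" .
    have "(\<Sum>i<N. adj_matrix E j i * h i) = h (g j) + r"
      unfolding r_def using gj by (subst sum.remove[of _ "g j"]) auto
    moreover have "(\<Sum>i<N. adj_matrix E j i * \<bar>h i\<bar>) = \<bar>h (g j)\<bar> + (\<Sum>i\<in>{..<N} - {g j}. adj_matrix E j i * \<bar>h i\<bar>)"
      using gj by (subst sum.remove[of _ "g j"]) auto
    ultimately show ?thesis using r by linarith
  qed
  have edges: "(\<Sum>j\<in>E `` T. \<Sum>i<N. adj_matrix E j i * \<bar>h i\<bar>) = (\<Sum>i<N. \<bar>h i\<bar> * e i)"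
    by (subst sum.swap, intro sum.cong) (simp_all add: e_def mult.commute sum_distrib_left flip: sum_adj[OF sub])
  also have "\<dots> = (\<Sum>i\<in>{..<N} - T. \<bar>h i\<bar> * e i) + (\<Sum>i\<in>T. \<bar>h i\<bar> * e i)"
    using T' by (intro sum.subset_diff) auto
  also have "(\<Sum>i\<in>T. \<bar>h i\<bar> * e i) = real d * (\<Sum>i\<in>T. \<bar>h i\<bar>)"
  proof -
    have "e i = real d" if "i \<in> T" for i
    proof -
      have "E `` {i} \<inter> E `` T = E `` {i}" using that by auto
      then show ?thesis using card_nbhd that T' by (auto simp: e_def)
    qed
    then show ?thesis by (simp add: sum_distrib_left mult.commute)
  qed
  finally have edges: "(\<Sum>j\<in>E `` T. \<Sum>i<N. adj_matrix E j i * \<bar>h i\<bar>)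
      \<le> 2 * \<epsilon> * real d * norm1 N h + real d * (\<Sum>i\<in>T. \<bar>h i\<bar>)"
    using tail_collisions[OF T m] unfolding e_def by simp
  have "2 * ((1 - \<epsilon>) * real d * (\<Sum>i\<in>T. \<bar>h i\<bar>)) - (2 * \<epsilon> * real d * norm1 N h + real d * (\<Sum>i\<in>T. \<bar>h i\<bar>))
      \<le> (\<Sum>j\<in>E `` T. 2 * \<bar>h (g j)\<bar> - (\<Sum>i<N. adj_matrix E j i * \<bar>h i\<bar>))"
    using g(2) edges by (simp add: sum_subtractf flip: sum_distrib_left)
  also have "\<dots> \<le> (\<Sum>j\<in>E `` T. \<bar>\<Sum>i<N. adj_matrix E j i * h i\<bar>)"
    by (intro sum_mono point)
  also have "\<dots> \<le> (\<Sum>j<M. \<bar>\<Sum>i<N. adj_matrix E j i * h i\<bar>)"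
    using sub by (intro sum_mono2) auto
  also have "\<dots> = real d * norm1 M (mat_app N \<Phi> h)"
  proof -
    have "mat_app N \<Phi> h j = (\<Sum>i<N. adj_matrix E j i * h i) / real d" for j
      by (simp add: mat_app_def \<Phi>_def sum_divide_distrib)
    then have "norm1 M (mat_app N \<Phi> h) = (\<Sum>j<M. \<bar>\<Sum>i<N. adj_matrix E j i * h i\<bar>) / real d"
      by (simp add: norm1_def flip: sum_divide_distrib)
    then show ?thesis using d_pos by simp
  qed
  finally have "real d * ((1 - 2 * \<epsilon>) * (\<Sum>i\<in>T. \<bar>h i\<bar>)) \<le> real d * (norm1 M (mat_app N \<Phi> h) + 2 * \<epsilon> * norm1 N h)"
    by (simp add: algebra_simps)
  then show ?thesis using d_pos by simp
qed

text \<open>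
  Nonnegativity makes \<open>\<Sum>i<N. v i - u i\<close> visible to \<open>\<Phi>\<close>, since the columns of \<open>\<Phi>\<close> sum to 1; this
  replaces the norm comparison of compressed sensing.
\<close>

lemma norm1_diff_le_measurements:
  assumes \<epsilon>: "\<epsilon> = 1 / 16" and m: "1 \<le> m" "2 * m \<le> k" "m \<le> N"
    and u: "\<And>i. 0 \<le> u i" and v: "\<And>i. 0 \<le> v i"
  shows "norm1 N (\<lambda>i. v i - u i) \<le> 5 * norm1 M (mat_app N \<Phi> (\<lambda>i. v i - u i)) + 3 * best_approx_err N m u"
proof -
  define h where "h i = v i - u i" for i
  define \<Delta> where "\<Delta> = norm1 M (mat_app N \<Phi> h)"
  obtain S where S: "S \<subseteq> {..<N}" "card S = m" "best_approx_err N m u = (\<Sum>i\<in>{..<N} - S. \<bar>u i\<bar>)"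
    using best_approx_err_positions[OF m(3)] .
  obtain T where T: "top_positions N h m T" using ex_top_positions[OF m(3)] by blast
  \<comment> \<open>The largest coordinates of \<open>u\<close> sit on \<open>S\<close>, those of
    \<open>h\<close> on \<open>T\<close>. The estimate on \<open>T\<close> passes to
    \<open>S\<close> because both sets have size \<open>m\<close>.\<close>
  have hS: "(7 / 8) * (\<Sum>i\<in>S. \<bar>h i\<bar>) \<le> \<Delta> + (1 / 8) * norm1 N h"
    using top_positions_norm_le[OF T m(1,2)] sum_top_positions_ge[OF T S(1,2)] \<epsilon> unfolding \<Delta>_def by simp
  have "(\<Sum>i<N. h i) = (\<Sum>j<M. mat_app N \<Phi> h j)" by (simp add: sum_mat_app_\<Phi>)
  also have "\<dots> \<le> \<Delta>" unfolding \<Delta>_def norm1_def by (intro sum_mono) auto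
  finally have sum_h: "(\<Sum>i<N. h i) \<le> \<Delta>" .
  have "norm1 N h = (\<Sum>i\<in>{..<N} - S. \<bar>h i\<bar>) + (\<Sum>i\<in>S. \<bar>h i\<bar>)"
    unfolding norm1_def using S by (intro sum.subset_diff) auto
  \<comment> \<open>Since \<open>v\<close> is nonnegative, the negative part of \<open>h\<close> is
    at most \<open>u\<close>.\<close>
  moreover have "(\<Sum>i\<in>{..<N} - S. \<bar>h i\<bar>) \<le> (\<Sum>i\<in>{..<N} - S. h i + 2 * \<bar>u i\<bar>)"
    by (rule sum_mono) (use u v in \<open>auto simp: h_def abs_le_iff add_increasing2\<close>)
  moreover have "(\<Sum>i\<in>{..<N} - S. h i) = (\<Sum>i<N. h i) - (\<Sum>i\<in>S. h i)"
    using S by (simp add: sum_diff)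
  moreover have "- (\<Sum>i\<in>S. h i) \<le> (\<Sum>i\<in>S. \<bar>h i\<bar>)"
    unfolding sum_negf[symmetric] by (intro sum_mono) auto
  ultimately have "norm1 N h \<le> \<Delta> + 2 * best_approx_err N m u + 2 * (\<Sum>i\<in>S. \<bar>h i\<bar>)"
    using sum_h S(3) by (simp add: sum.distrib flip: sum_distrib_left)
  moreover have "best_approx_err N m u \<ge> 0" unfolding S(3) by (intro sum_nonneg) auto
  moreover have "\<Delta> \<ge> 0" unfolding \<Delta>_def norm1_def by (intro sum_nonneg) auto
  \<comment> \<open>Inserting \<open>hS\<close> gives \<open>5 / 7\<close> of the norm on the left,
    hence the factors \<open>23 / 5\<close> and \<open>14 / 5\<close>, rounded up to 5 and
    3.\<close>
  ultimately show ?thesis using hS unfolding \<Delta>_def h_def[abs_def] by (simp add: field_simps)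
qed

end

subsection \<open>Dependent rounding\<close>

lemma sum_add_delta_pair:
  fixes f a :: "nat \<Rightarrow> real"
  assumes "i < n" "p < n"
  shows "(\<Sum>l<n. f l * (a l + t * (of_bool (l = i) - of_bool (l = p)))) = (\<Sum>l<n. f l * a l) + t * (f i - f p)"
proof -
  have "(\<Sum>l<n. f l * (a l + t * (of_bool (l = i) - of_bool (l = p)))) =
      (\<Sum>l<n. f l * a l) + t * ((\<Sum>l<n. f l * of_bool (l = i)) - (\<Sum>l<n. f l * of_bool (l = p)))"
    unfolding right_diff_distrib sum_distrib_left sum_subtractf[symmetric] sum.distrib[symmetric]
    by (intro sum.cong) (auto simp: algebra_simps)
  also have "(\<Sum>l<n. f l * of_bool (l = q)) = f q" if "q < n" for q
    using that by (simp add: of_bool_def if_distrib[of "(*) _"] cong: if_cong)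
  then have "t * ((\<Sum>l<n. f l * of_bool (l = i)) - (\<Sum>l<n. f l * of_bool (l = p))) = t * (f i - f p)"
    using assms by simp
  finally show ?thesis .
qed

text \<open>
  Dependent rounding. The function \<open>\<parallel>B (w - x)\<parallel>\<^sup>2 - \<kappa> \<parallel>w - x\<parallel>\<^sup>2\<close> is concave along \<open>e\<^sub>i - e\<^sub>p\<close>, so one
  of two fractional coordinates can be made integral, at constant sum, without increasing it.
\<close>

locale dependent_rounding =
  fixes n M :: nat and B :: "nat \<Rightarrow> nat \<Rightarrow> real" and \<kappa> :: real and x :: "nat \<Rightarrow> real" and s :: int
  assumes B_nonneg: "0 \<le> B j i" and column: "i < n \<Longrightarrow> (\<Sum>j<M. (B j i)\<^sup>2) \<le> \<kappa>"
    and sum_x: "(\<Sum>i<n. x i) = of_int s"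
begin

definition potential :: "(nat \<Rightarrow> real) \<Rightarrow> real" where
  "potential w = (\<Sum>j<M. (\<Sum>i<n. B j i * (w i - x i))\<^sup>2) - \<kappa> * (\<Sum>i<n. (w i - x i)\<^sup>2)"

definition admissible :: "(nat \<Rightarrow> real) \<Rightarrow> bool" where
  "admissible w \<longleftrightarrow> (\<forall>i<n. of_int \<lfloor>x i\<rfloor> \<le> w i \<and> w i \<le> of_int \<lceil>x i\<rceil>) \<and>
     (\<Sum>i<n. w i) = of_int s \<and> potential w \<le> 0"

definition fractional :: "(nat \<Rightarrow> real) \<Rightarrow> nat set" where
  "fractional w = {i. i < n \<and> w i \<notin> \<int>}"

text \<open>The coefficient of the square of \<open>t\<close> is the squared distance of columns
  \<open>i\<close> and \<open>p\<close> minus \<open>2 * \<kappa>\<close>. It is at most 0, because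
  the cross terms of nonnegative columns only reduce that distance. The function \<open>g\<close> is
  half the gradient of \<open>potential\<close>.\<close>

lemma potential_shift:
  assumes i: "i < n" and p: "p < n" and "i \<noteq> p"
    and w': "\<And>l. w' l = w l + t * (of_bool (l = i) - of_bool (l = p))"
  defines "g \<equiv> \<lambda>q. (\<Sum>j<M. B j q * (\<Sum>l<n. B j l * (w l - x l))) - \<kappa> * (w q - x q)"
  shows "potential w' \<le> potential w + 2 * t * (g i - g p)"
proof -
  define r where "r j = (\<Sum>l<n. B j l * (w l - x l))" for j
  define a where "a l = w l - x l" for l
  have w'x: "w' l - x l = a l + t * (of_bool (l = i) - of_bool (l = p))" for l
    unfolding w' a_def by simp
  have r': "(\<Sum>l<n. B j l * (w' l - x l)) = r j + t * (B j i - B j p)" for j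
    unfolding w'x r_def a_def[symmetric] by (rule sum_add_delta_pair[OF i p])
  have 1: "(\<Sum>j<M. (\<Sum>l<n. B j l * (w' l - x l))\<^sup>2) =
      (\<Sum>j<M. (r j)\<^sup>2) + 2 * t * ((\<Sum>j<M. B j i * r j) - (\<Sum>j<M. B j p * r j)) + t\<^sup>2 * (\<Sum>j<M. (B j i - B j p)\<^sup>2)"
    unfolding r' sum_subtractf[symmetric] sum_distrib_left sum.distrib[symmetric]
    by (intro sum.cong) (auto simp: power2_eq_square algebra_simps)
  have "(\<Sum>l<n. (w' l - x l)\<^sup>2) = (\<Sum>l<n. (w' l - x l) * (a l + t * (of_bool (l = i) - of_bool (l = p))))"
    unfolding w'x by (simp add: power2_eq_square)
  also have "\<dots> = (\<Sum>l<n. (w' l - x l) * a l) + t * ((w' i - x i) - (w' p - x p))"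
    by (rule sum_add_delta_pair[OF i p])
  also have "(\<Sum>l<n. (w' l - x l) * a l) = (\<Sum>l<n. a l * (a l + t * (of_bool (l = i) - of_bool (l = p))))"
    unfolding w'x by (simp add: mult.commute)
  also have "\<dots> = (\<Sum>l<n. a l * a l) + t * (a i - a p)"
    by (rule sum_add_delta_pair[OF i p])
  finally have 2: "(\<Sum>l<n. (w' l - x l)\<^sup>2) = (\<Sum>l<n. (a l)\<^sup>2) + 2 * t * (a i - a p) + 2 * t\<^sup>2"
    using \<open>i \<noteq> p\<close> unfolding w'x by (simp add: power2_eq_square algebra_simps)
  have "(\<Sum>j<M. (B j i - B j p)\<^sup>2) \<le> (\<Sum>j<M. (B j i)\<^sup>2 + (B j p)\<^sup>2)"
    using B_nonneg by (intro sum_mono) (simp add: power2_diff)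
  also have "\<dots> \<le> 2 * \<kappa>" using column[OF i] column[OF p] by (simp add: sum.distrib)
  finally have "t\<^sup>2 * (\<Sum>j<M. (B j i - B j p)\<^sup>2) \<le> t\<^sup>2 * (2 * \<kappa>)" by (intro mult_left_mono) auto
  moreover have pot: "(\<Sum>j<M. (r j)\<^sup>2) = potential w + \<kappa> * (\<Sum>l<n. (a l)\<^sup>2)"
    by (simp add: potential_def r_def a_def)
  moreover have grad: "(\<Sum>j<M. B j q * r j) = g q + \<kappa> * a q" for q
    by (simp add: g_def r_def a_def)
  ultimately show ?thesis
    unfolding potential_def[of w'] 1 2 pot grad by (simp add: algebra_simps)
qed

text \<open>A single fractional coordinate would be the difference of the integer \<open>s\<close>
  and a sum of integers.\<close>

lemma two_fractional:
  assumes "admissible w" "fractional w \<noteq> {}"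
  shows "\<exists>i\<in>fractional w. \<exists>p\<in>fractional w. i \<noteq> p"
proof (rule ccontr)
  assume *: "\<not> ?thesis"
  obtain i where i: "i \<in> fractional w" using assms by auto
  then have "i < n" by (simp add: fractional_def)
  have "w l \<in> \<int>" if "l \<in> {..<n} - {i}" for l
    using that * i by (auto simp: fractional_def)
  then have "(\<Sum>l\<in>{..<n} - {i}. w l) \<in> \<int>" by (intro Ints_sum) auto
  moreover have "w i = of_int s - (\<Sum>l\<in>{..<n} - {i}. w l)"
    using assms(1) \<open>i < n\<close> unfolding admissible_def by (simp add: sum_diff1)
  ultimately have "w i \<in> \<int>" by (metis Ints_diff Ints_of_int)
  then show False using i by (simp add: fractional_def)
qed

lemma rounding_step:
  assumes adm: "admissible w" and frac: "fractional w \<noteq> {}"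
  shows "\<exists>w'. admissible w' \<and> card (fractional w') < card (fractional w)"
proof -
  define g where "g q = (\<Sum>j<M. B j q * (\<Sum>l<n. B j l * (w l - x l))) - \<kappa> * (w q - x q)" for q
  \<comment> \<open>The names are chosen by slope, so that moving mass from \<open>p\<close> to
    \<open>i\<close> cannot raise the potential.\<close>
  obtain i p where ip: "i \<in> fractional w" "p \<in> fractional w" "i \<noteq> p" "g i \<le> g p"
    using two_fractional[OF adm frac] by (metis linorder_linear)
  then have in_n: "i < n" "p < n" "w i \<notin> \<int>" "w p \<notin> \<int>" by (auto simp: fractional_def)
  \<comment> \<open>The largest move that keeps both coordinates within their unit cells. It makes
    at least one of them an integer.\<close>
  define t where "t = min (of_int \<lceil>w i\<rceil> - w i) (w p - of_int \<lfloor>w p\<rfloor>)"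
  define w' where "w' l = w l + t * (of_bool (l = i) - of_bool (l = p))" for l
  have t: "0 \<le> t" "t \<le> of_int \<lceil>w i\<rceil> - w i" "t \<le> w p - of_int \<lfloor>w p\<rfloor>"
    unfolding t_def by (auto simp: le_of_int_ceiling)
  have range: "of_int \<lfloor>x l\<rfloor> \<le> w l" "w l \<le> of_int \<lceil>x l\<rceil>" if "l < n" for l
    using adm that unfolding admissible_def by auto
  have "of_int \<lceil>w i\<rceil> \<le> (of_int \<lceil>x i\<rceil> :: real)"
    using range(2)[OF in_n(1)] by (simp add: ceiling_le)
  moreover have "(of_int \<lfloor>x p\<rfloor> :: real) \<le> of_int \<lfloor>w p\<rfloor>"
    using range(1)[OF in_n(2)] by (simp add: le_floor_iff)
  ultimately have "of_int \<lfloor>x l\<rfloor> \<le> w' l \<and> w' l \<le> of_int \<lceil>x l\<rceil>" if "l < n" for l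
    using range[OF that] t \<open>i \<noteq> p\<close> by (auto simp: w'_def)
  moreover have "(\<Sum>l<n. w' l) = of_int s"
    using sum_add_delta_pair[OF in_n(1,2), of "\<lambda>_. 1" w t] adm by (simp add: w'_def admissible_def)
  moreover have "potential w' \<le> 0"
  proof -
    have "potential w' \<le> potential w + 2 * t * (g i - g p)"
      unfolding g_def by (rule potential_shift[OF in_n(1,2) ip(3)]) (rule w'_def)
    also have "\<dots> \<le> potential w" using t ip by (simp add: mult_nonneg_nonpos)
    finally show ?thesis using adm by (simp add: admissible_def)
  qed
  ultimately have "admissible w'" by (simp add: admissible_def)
  moreover have "fractional w' \<subset> fractional w"
  proof -
    have "w' i = of_int \<lceil>w i\<rceil> \<or> w' p = of_int \<lfloor>w p\<rfloor>"
      using \<open>i \<noteq> p\<close> by (auto simp: w'_def t_def min_def)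
    then have "w' i \<in> \<int> \<or> w' p \<in> \<int>" by auto
    moreover have "fractional w' \<subseteq> fractional w"
      using ip(1,2) by (auto simp: fractional_def w'_def)
    ultimately show ?thesis using ip(1,2) by (auto simp: fractional_def)
  qed
  then have "card (fractional w') < card (fractional w)"
    by (intro psubset_card_mono) (auto simp: fractional_def)
  ultimately show ?thesis by blast
qed

lemma admissible_integral: "admissible w \<Longrightarrow> \<exists>w'. admissible w' \<and> fractional w' = {}"
proof (induction "card (fractional w)" arbitrary: w rule: less_induct)
  case less
  then show ?case using rounding_step by blast
qed

lemma rounding:
  "\<exists>z :: nat \<Rightarrow> int. (\<forall>i<n. \<lfloor>x i\<rfloor> \<le> z i \<and> z i \<le> \<lceil>x i\<rceil>) \<and> (\<Sum>i<n. z i) = s \<and>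
     (\<Sum>j<M. (\<Sum>i<n. B j i * (z i - x i))\<^sup>2) \<le> \<kappa> * (\<Sum>i<n. (z i - x i)\<^sup>2)"
proof -
  have "admissible x" by (simp add: admissible_def potential_def sum_x le_of_int_ceiling)
  then obtain w where w: "admissible w" "fractional w = {}" using admissible_integral by blast
  define z where "z i = \<lfloor>w i\<rfloor>" for i
  have wz: "w i = of_int (z i)" if "i < n" for i
    using w(2) that by (auto simp: fractional_def z_def elim: Ints_cases)
  have z: "\<lfloor>x i\<rfloor> \<le> z i \<and> z i \<le> \<lceil>x i\<rceil>" if "i < n" for i
    using w(1) that wz[OF that] unfolding admissible_def by auto
  moreover have "(\<Sum>i<n. z i) = s"
  proof -
    have "(of_int (\<Sum>i<n. z i) :: real) = of_int s"
      using w(1) wz by (simp add: admissible_def)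
    then show ?thesis by (simp only: of_int_eq_iff)
  qed
  moreover have "(\<Sum>j<M. (\<Sum>i<n. B j i * (z i - x i))\<^sup>2) \<le> \<kappa> * (\<Sum>i<n. (z i - x i)\<^sup>2)"
    using w(1) wz by (simp add: admissible_def potential_def)
  ultimately show ?thesis by blast
qed

end

section \<open>Sparse approximation on the grid\<close>

text \<open>Cauchy-Schwarz with weights \<open>\<bar>u i\<bar>\<close> in every row, then summation
  over the rows, where only the squared column norms remain.\<close>

lemma mat_app_square_le_norm1:
  assumes "\<And>i. i < N \<Longrightarrow> (\<Sum>j<M. (B j i)\<^sup>2) \<le> \<kappa>"
  shows "(\<Sum>j<M. (mat_app N B u j)\<^sup>2) \<le> \<kappa> * (norm1 N u)\<^sup>2"
proof -
  have "(mat_app N B u j)\<^sup>2 \<le> (\<Sum>i<N. (B j i)\<^sup>2 * \<bar>u i\<bar>) * norm1 N u" for j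
  proof -
    have "mat_app N B u j = (\<Sum>i<N. (B j i * sqrt \<bar>u i\<bar>) * (sgn (u i) * sqrt \<bar>u i\<bar>))"
      unfolding mat_app_def by (intro sum.cong) (auto simp: mult_ac abs_mult_sgn)
    then have "(mat_app N B u j)\<^sup>2 \<le> (\<Sum>i<N. (B j i * sqrt \<bar>u i\<bar>)\<^sup>2) * (\<Sum>i<N. (sgn (u i) * sqrt \<bar>u i\<bar>)\<^sup>2)"
      using Cauchy_Schwarz_ineq_sum by simp
    also have "(\<Sum>i<N. (sgn (u i) * sqrt \<bar>u i\<bar>)\<^sup>2) = norm1 N u"
      unfolding norm1_def by (intro sum.cong) (auto simp: power_mult_distrib sgn_if)
    finally show ?thesis by (simp add: power_mult_distrib)
  qed
  then have "(\<Sum>j<M. (mat_app N B u j)\<^sup>2) \<le> (\<Sum>j<M. (\<Sum>i<N. (B j i)\<^sup>2 * \<bar>u i\<bar>) * norm1 N u)"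
    by (rule sum_mono)
  also have "\<dots> = (\<Sum>i<N. (\<Sum>j<M. (B j i)\<^sup>2) * \<bar>u i\<bar>) * norm1 N u"
    unfolding sum_distrib_right[symmetric] by (subst sum.swap) (simp only: sum_distrib_right)
  also have "\<dots> \<le> (\<Sum>i<N. \<kappa> * \<bar>u i\<bar>) * norm1 N u"
    using assms by (intro mult_right_mono sum_mono) (auto simp: norm1_def sum_nonneg)
  also have "\<dots> = \<kappa> * (norm1 N u)\<^sup>2"
    by (simp add: norm1_def power2_eq_square flip: sum_distrib_left)
  finally show ?thesis .
qed

lemma square_sum_le: "((a::real) + b)\<^sup>2 \<le> 2 * a\<^sup>2 + 2 * b\<^sup>2"
  using zero_le_power2[of "a - b"] by (simp add: power2_sum power2_diff)

lemma sum_mat_app_add_square_le: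
  "(\<Sum>j<M. (mat_app N B (\<lambda>i. u i + v i) j)\<^sup>2) \<le>
    2 * (\<Sum>j<M. (mat_app N B u j)\<^sup>2) + 2 * (\<Sum>j<M. (mat_app N B v j)\<^sup>2)"
proof -
  have "mat_app N B (\<lambda>i. u i + v i) j = mat_app N B u j + mat_app N B v j" for j
    by (simp add: mat_app_def distrib_left sum.distrib)
  then have "(\<Sum>j<M. (mat_app N B (\<lambda>i. u i + v i) j)\<^sup>2) \<le> (\<Sum>j<M. 2 * (mat_app N B u j)\<^sup>2 + 2 * (mat_app N B v j)\<^sup>2)"
    by (intro sum_mono) (simp add: square_sum_le)
  then show ?thesis by (simp add: sum.distrib sum_distrib_left)
qed

text \<open>
  The slack \<open>R - \<Sum>i<N. x i\<close> is rounded as an additional coordinate that \<open>B\<close> does not see.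
  A rounding to zero is replaced by a unit vector, because the penalty of the zero vector is
  not bounded from above.
\<close>

lemma sparse_rounding:
  fixes x :: "nat \<Rightarrow> real"
  assumes B: "\<And>j i. 0 \<le> B j i" and col: "\<And>i. i < N \<Longrightarrow> (\<Sum>j<M. (B j i)\<^sup>2) \<le> \<kappa>"
    and x: "\<And>i. 0 \<le> x i" "\<And>i. i \<notin> S \<Longrightarrow> x i = 0" "(\<Sum>i<N. x i) \<le> real R"
    and S: "S \<subseteq> {..<N}" "S \<noteq> {}" and R: "R \<ge> 1"
  shows "\<exists>z :: nat \<Rightarrow> nat. (\<forall>i. i \<notin> S \<longrightarrow> z i = 0) \<and> (\<exists>i. z i \<noteq> 0) \<and> (\<Sum>i<N. z i) \<le> R \<and>
    (\<Sum>j<M. (mat_app N B (\<lambda>i. z i - x i) j)\<^sup>2) \<le> 6 * \<kappa> * real (card S)"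
proof -
  have finS: "finite S" using S finite_subset by blast
  obtain q where q: "q \<in> S" using S by auto
  then have "q < N" using S by auto
  have "0 \<le> (\<Sum>j<M. (B j q)\<^sup>2)" by (intro sum_nonneg) auto
  then have \<kappa>: "\<kappa> \<ge> 0" using col[OF \<open>q < N\<close>] by linarith
  define B' where "B' j i = (if i < N then B j i else 0)" for j i
  define x' where "x' i = (if i < N then x i else real R - (\<Sum>i<N. x i))" for i
  interpret dependent_rounding "Suc N" M B' \<kappa> x' "int R"
  proof
    show "0 \<le> B' j i" for j i using B by (simp add: B'_def)
    show "(\<Sum>j<M. (B' j i)\<^sup>2) \<le> \<kappa>" for i using col \<kappa> by (cases "i < N") (simp_all add: B'_def)
    show "(\<Sum>i<Suc N. x' i) = of_int (int R)" by (simp add: x'_def)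
  qed
  obtain y :: "nat \<Rightarrow> int" where y: "\<And>i. i < Suc N \<Longrightarrow> \<lfloor>x' i\<rfloor> \<le> y i \<and> y i \<le> \<lceil>x' i\<rceil>"
      "(\<Sum>i<Suc N. y i) = int R"
      "(\<Sum>j<M. (\<Sum>i<Suc N. B' j i * (y i - x' i))\<^sup>2) \<le> \<kappa> * (\<Sum>i<Suc N. (y i - x' i)\<^sup>2)"
    using rounding by blast
  have x'_nonneg: "0 \<le> x' i" for i using x by (simp add: x'_def)
  have y_nonneg: "0 \<le> y i" if "i < Suc N" for i
    using y(1)[OF that] x'_nonneg[of i] by (metis order_trans zero_le_floor)
  define z where "z i = (if i < N then nat (y i) else 0)" for i
  have zy: "int (z i) = y i" if "i < N" for i using that y_nonneg[of i] by (simp add: z_def)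
  \<comment> \<open>Floor and ceiling agree at the integer 0, so the rounding preserves the
    support.\<close>
  have z0: "z i = 0" if "i \<notin> S" for i
    using y(1)[of i] x(2)[OF that] by (auto simp: z_def x'_def)
  have sum_z: "(\<Sum>i<N. z i) \<le> R"
  proof -
    have "int (\<Sum>i<N. z i) = (\<Sum>i<N. y i)" using zy by simp
    also have "\<dots> \<le> int R" using y(2) y_nonneg[of N] by simp
    finally show ?thesis by (simp only: of_nat_le_iff)
  qed
  have diff_le: "(y i - x' i)\<^sup>2 \<le> 1" if "i < Suc N" for i
  proof -
    have "\<bar>y i - x' i\<bar> \<le> 1" using y(1)[OF that] by linarith
    then show ?thesis by (simp add: abs_square_le_1)
  qed
  have "(\<Sum>i<N. (y i - x' i)\<^sup>2) = (\<Sum>i\<in>S. (y i - x' i)\<^sup>2)"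
    using S(1) z0 x(2) zy by (intro sum.mono_neutral_right) (force simp: x'_def)+
  also have "\<dots> \<le> (\<Sum>i\<in>S. 1)" using S(1) diff_le by (intro sum_mono) auto
  \<comment> \<open>The extra 1 is the slack coordinate.\<close>
  finally have "(\<Sum>i<Suc N. (y i - x' i)\<^sup>2) \<le> real (card S) + 1"
    using diff_le[of N] by simp
  moreover have "(\<Sum>i<Suc N. B' j i * (y i - x' i)) = mat_app N B (\<lambda>i. z i - x i) j" for j
  proof -
    have "real (z i) = of_int (y i)" if "i < N" for i
      using zy[OF that] by (metis of_int_of_nat_eq)
    then have "(\<Sum>i<N. B' j i * (y i - x' i)) = mat_app N B (\<lambda>i. z i - x i) j"
      unfolding mat_app_def by (intro sum.cong) (simp_all add: B'_def x'_def)
    moreover have "B' j N = 0" by (simp add: B'_def)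
    ultimately show ?thesis by simp
  qed
  moreover have "\<kappa> * (\<Sum>i<Suc N. (y i - x' i)\<^sup>2) \<le> \<kappa> * (real (card S) + 1)"
    using \<kappa> calculation(1) by (rule mult_left_mono[rotated])
  ultimately have z: "(\<Sum>j<M. (mat_app N B (\<lambda>i. z i - x i) j)\<^sup>2) \<le> \<kappa> * (real (card S) + 1)"
    using y(3) by simp
  have S1: "1 \<le> real (card S)" using finS S(2) by (simp add: Suc_le_eq card_gt_0_iff)
  show ?thesis
  proof (cases "\<exists>i. z i \<noteq> 0")
    case True
    have "\<kappa> * (real (card S) + 1) \<le> \<kappa> * (6 * real (card S))" using \<kappa> S1 by (intro mult_left_mono) auto
    then show ?thesis using True z z0 sum_z by (intro exI[of _ z]) (auto simp: mult_ac)
  next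
    case False
    define z' where "z' i = (of_bool (i = q) :: nat)" for i
    have "(\<lambda>i. real (z' i) - x i) = (\<lambda>i. of_bool (i = q) + (real (z i) - x i))"
      using False by (auto simp: z'_def)
    moreover have "(\<Sum>j<M. (mat_app N B (\<lambda>i. of_bool (i = q)) j)\<^sup>2) \<le> \<kappa>"
      using col[OF \<open>q < N\<close>] \<open>q < N\<close> by (simp add: mat_app_def of_bool_def if_distrib[of "(*) _"] cong: if_cong)
    ultimately have "(\<Sum>j<M. (mat_app N B (\<lambda>i. z' i - x i) j)\<^sup>2) \<le> 2 * \<kappa> + 2 * (\<kappa> * (real (card S) + 1))"
      using sum_mat_app_add_square_le[where N = N and M = M and B = B and u = "\<lambda>i. of_bool (i = q)" and v = "\<lambda>i. real (z i) - x i"] z by simp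
    \<comment> \<open>The left side is \<open>4 * \<kappa> + 2 * \<kappa> * card S\<close>, and
      \<open>S\<close> is nonempty.\<close>
    also have "\<dots> \<le> 6 * \<kappa> * real (card S)"
    proof -
      have "\<kappa> * 1 \<le> \<kappa> * real (card S)" using \<kappa> S1 by (intro mult_left_mono) auto
      then show ?thesis by (simp add: algebra_simps)
    qed
    finally show ?thesis
      using q R \<open>q < N\<close> by (intro exI[of _ z']) (auto simp: z'_def of_bool_def)
  qed
qed

text \<open>The \<open>m\<close> largest coordinates are expressed in units of
  \<open>sqrt \<delta>\<close> and rounded; the remaining ones are dropped. The integer
  \<open>L0 / sqrt \<delta>\<close> is the budget of the rounding and keeps the result in the class.
  Splitting the square into these two errors doubles the constants 1 and 6.\<close>

lemma quantized_approximation: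
  assumes B: "\<And>j i. 0 \<le> B j i" and col: "\<And>i. i < N \<Longrightarrow> (\<Sum>j<M. (B j i)\<^sup>2) \<le> \<kappa>"
    and l: "l \<in> nonneg_vecs N" "norm1 N l \<le> L0" and L0: "L0 > 0"
    and \<delta>: "0 < \<delta>" "L0 / sqrt \<delta> \<in> \<nat>" and m: "1 \<le> m" "m \<le> N"
  obtains l' where "l' \<in> quantized_class N L0 \<delta>" "l' \<noteq> (\<lambda>_. 0)" "norm0 N l' \<le> m"
    "(\<Sum>j<M. (mat_app N B (\<lambda>i. l i - l' i) j)\<^sup>2) \<le> \<kappa> * (2 * (best_approx_err N m l)\<^sup>2 + 12 * real m * \<delta>)"
proof -
  obtain S where S: "S \<subseteq> {..<N}" "card S = m" "best_approx_err N m l = (\<Sum>i\<in>{..<N} - S. \<bar>l i\<bar>)"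
    using best_approx_err_positions[OF m(2)] .
  obtain R where R: "L0 / sqrt \<delta> = real R" using \<delta>(2) by (elim Nats_cases)
  then have "real R > 0" using L0 \<delta>(1) by (metis divide_pos_pos real_sqrt_gt_zero)
  then have "R \<ge> 1" by simp
  have L0R: "L0 = real R * sqrt \<delta>" using R \<delta>(1) by (simp add: field_simps)
  have l_nonneg: "0 \<le> l i" for i using l by (simp add: nonneg_vecs_def)
  define x where "x i = (if i \<in> S then l i / sqrt \<delta> else 0)" for i
  have "(\<Sum>i<N. x i) \<le> (\<Sum>i<N. l i / sqrt \<delta>)"
    using l_nonneg \<delta>(1) by (intro sum_mono) (auto simp: x_def)
  also have "\<dots> = norm1 N l / sqrt \<delta>"
    using l_nonneg by (simp add: norm1_def sum_divide_distrib)
  also have "\<dots> \<le> real R" unfolding R[symmetric] using l \<delta>(1) by (intro divide_right_mono) auto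
  finally have sum_x: "(\<Sum>i<N. x i) \<le> real R" .
  obtain z :: "nat \<Rightarrow> nat" where z: "\<And>i. i \<notin> S \<Longrightarrow> z i = 0" "\<exists>i. z i \<noteq> 0" "(\<Sum>i<N. z i) \<le> R"
      "(\<Sum>j<M. (mat_app N B (\<lambda>i. z i - x i) j)\<^sup>2) \<le> 6 * \<kappa> * real (card S)"
  proof -
    have "S \<noteq> {}" using S m by auto
    moreover have "0 \<le> x i" "i \<notin> S \<Longrightarrow> x i = 0" for i using l_nonneg \<delta>(1) by (simp_all add: x_def)
    ultimately show ?thesis
      using that sparse_rounding[of B N M \<kappa> x S R] B col sum_x S(1) \<open>R \<ge> 1\<close> by blast
  qed
  define l' where "l' i = real (z i) * sqrt \<delta>" for i
  have z_le: "z i \<le> R" if "i < N" for i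
    using z(3) member_le_sum[of i "{..<N}" z] that by simp
  have l'_class: "l' \<in> quantized_class N L0 \<delta>"
  proof -
    have "l' \<in> nonneg_vecs N" using z(1) S(1) \<delta>(1) by (force simp: nonneg_vecs_def l'_def)
    moreover have "norm1 N l' \<le> L0"
    proof -
      have "norm1 N l' = real (\<Sum>i<N. z i) * sqrt \<delta>"
        using \<delta>(1) by (simp add: norm1_def l'_def sum_distrib_right)
      also have "\<dots> \<le> L0" unfolding L0R using z(3) \<delta>(1) by (intro mult_right_mono of_nat_mono) auto
      finally show ?thesis .
    qed
    moreover have "\<exists>m::nat. l' i = real m * sqrt \<delta> \<and> real m \<le> L0 / sqrt \<delta>" if "i < N" for i
      using z_le[OF that] R by (auto simp: l'_def)
    ultimately show ?thesis by (auto simp: quantized_class_def)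
  qed
  have l'_nz: "l' \<noteq> (\<lambda>_. 0)" using z(2) \<delta>(1) by (auto simp: l'_def fun_eq_iff)
  have l'_norm0: "norm0 N l' \<le> m"
  proof -
    have "i \<in> S" if "l' i \<noteq> 0" for i using z(1)[of i] that by (cases "i \<in> S") (simp_all add: l'_def)
    moreover have "finite S" using S(1) finite_subset by blast
    ultimately show ?thesis unfolding norm0_def S(2)[symmetric] by (intro card_mono) auto
  qed
  define tail where "tail i = (if i \<in> S then 0 else l i)" for i
  have split: "l i - l' i = tail i + (- sqrt \<delta>) * (real (z i) - x i)" for i
    using z(1)[of i] \<delta>(1) by (simp add: tail_def l'_def x_def algebra_simps)
  have "norm1 N tail = (\<Sum>i\<in>{..<N} - S. \<bar>tail i\<bar>)"
    unfolding norm1_def using S(1) by (intro sum.mono_neutral_right) (auto simp: tail_def)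
  also have "\<dots> = best_approx_err N m l"
    unfolding S(3) by (intro sum.cong) (auto simp: tail_def)
  finally have t: "(\<Sum>j<M. (mat_app N B tail j)\<^sup>2) \<le> \<kappa> * (best_approx_err N m l)\<^sup>2"
    using mat_app_square_le_norm1[where N = N and B = B and M = M and u = tail and \<kappa> = \<kappa>] col by simp
  have "mat_app N B (\<lambda>i. (- sqrt \<delta>) * (real (z i) - x i)) j = (- sqrt \<delta>) * mat_app N B (\<lambda>i. z i - x i) j" for j
    by (simp add: mat_app_def sum_distrib_left mult_ac sum_negf)
  then have "(\<Sum>j<M. (mat_app N B (\<lambda>i. (- sqrt \<delta>) * (real (z i) - x i)) j)\<^sup>2) = \<delta> * (\<Sum>j<M. (mat_app N B (\<lambda>i. z i - x i) j)\<^sup>2)"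
    using \<delta>(1) by (simp add: power_mult_distrib sum_distrib_left)
  also have "\<dots> \<le> \<delta> * (6 * \<kappa> * real m)"
    using z(4) \<delta>(1) S(2) by (intro mult_left_mono) auto
  finally have "(\<Sum>j<M. (mat_app N B (\<lambda>i. l i - l' i) j)\<^sup>2) \<le>
      2 * (\<kappa> * (best_approx_err N m l)\<^sup>2) + 2 * (\<delta> * (6 * \<kappa> * real m))"
    unfolding split
    using sum_mat_app_add_square_le[where N = N and B = B and M = M and u = tail
        and v = "\<lambda>i. (- sqrt \<delta>) * (real (z i) - x i)"] t by linarith
  then show ?thesis
    using that l'_class l'_nz l'_norm0 by (simp add: algebra_simps)
qed

subsection \<open>Penalized likelihood for Poisson counts\<close>

text \<open>The normalization \<open>exp (- \<mu>)\<close> is moved to the right-hand side, so that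
  a moment can be read off directly from a power series.\<close>

lemma
  fixes f :: "nat \<Rightarrow> real"
  assumes \<mu>: "\<mu> > 0" and f: "\<And>k. 0 \<le> f k" and s: "(\<lambda>k. f k * (\<mu> ^ k / fact k)) sums (s * exp \<mu>)"
  shows integrable_poisson_pmf: "integrable (measure_pmf (poisson_pmf \<mu>)) f"
    and expectation_poisson_pmf: "measure_pmf.expectation (poisson_pmf \<mu>) f = s"
proof -
  have s': "(\<lambda>k. pmf (poisson_pmf \<mu>) k * f k) sums s"
    using sums_mult2[OF s, of "exp (- \<mu>)"] \<mu> by (simp add: mult_ac exp_minus_inverse)
  have "integrable (count_space UNIV) (\<lambda>k. pmf (poisson_pmf \<mu>) k * f k)"
    unfolding integrable_count_space_nat_iff using s' f \<mu> by (auto simp: sums_iff abs_mult)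
  then have int: "integrable (count_space UNIV) (\<lambda>k. pmf (poisson_pmf \<mu>) k *\<^sub>R f k)" by simp
  then show "integrable (measure_pmf (poisson_pmf \<mu>)) f"
    unfolding measure_pmf_eq_density by (subst integrable_density) auto
  have "measure_pmf.expectation (poisson_pmf \<mu>) f = (\<integral>k. pmf (poisson_pmf \<mu>) k *\<^sub>R f k \<partial>count_space UNIV)"
    unfolding measure_pmf_eq_density by (subst integral_density) auto
  also have "\<dots> = s"
    using sums_integral_count_space_nat[OF int] s' by (auto intro: sums_unique2)
  finally show "measure_pmf.expectation (poisson_pmf \<mu>) f = s" .
qed

text \<open>The probability generating function, from which the Hellinger affinity is
  computed.\<close>

lemma poisson_power_sums:
  fixes t \<mu> :: real
  shows "(\<lambda>k. t ^ k * (\<mu> ^ k / fact k)) sums (exp (\<mu> * (t - 1)) * exp \<mu>)"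
proof -
  have "(\<lambda>k. (t * \<mu>) ^ k /\<^sub>R fact k) sums exp (t * \<mu>)" by (rule exp_converges)
  also have "exp (t * \<mu>) = exp (\<mu> * (t - 1)) * exp \<mu>" by (simp add: exp_add[symmetric] algebra_simps)
  finally show ?thesis by (simp add: power_mult_distrib divide_inverse mult_ac)
qed

lemma poisson_mean_sums:
  fixes \<mu> :: real
  shows "(\<lambda>k. real k * (\<mu> ^ k / fact k)) sums (\<mu> * exp \<mu>)"
proof -
  have "(\<lambda>k. \<mu> * (\<mu> ^ k /\<^sub>R fact k)) sums (\<mu> * exp \<mu>)" by (intro sums_mult exp_converges)
  also have "(\<lambda>k. \<mu> * (\<mu> ^ k /\<^sub>R fact k)) = (\<lambda>k. real (Suc k) * (\<mu> ^ Suc k / fact (Suc k)))"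
  proof
    fix k
    have "real (Suc k) * (\<mu> * \<mu> ^ k / (real (Suc k) * fact k)) = \<mu> * \<mu> ^ k / fact k"
      by (simp del: of_nat_Suc)
    then show "\<mu> * (\<mu> ^ k /\<^sub>R fact k) = real (Suc k) * (\<mu> ^ Suc k / fact (Suc k))"
      by (simp add: divide_inverse mult_ac del: of_nat_Suc)
  qed
  finally show ?thesis by (subst (asm) sums_Suc_iff) simp
qed

abbreviation poisson_marginal :: "real \<Rightarrow> nat pmf" where
  "poisson_marginal \<mu> \<equiv> (if \<mu> = 0 then return_pmf 0 else poisson_pmf \<mu>)"

lemma
  assumes "0 \<le> \<mu>" "0 \<le> t"
  shows integrable_poisson_marginal_power: "integrable (measure_pmf (poisson_marginal \<mu>)) (\<lambda>y. t ^ y)"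
    and expectation_poisson_marginal_power: "measure_pmf.expectation (poisson_marginal \<mu>) (\<lambda>y. t ^ y) = exp (\<mu> * (t - 1))"
  using assms integrable_poisson_pmf[OF _ _ poisson_power_sums, of \<mu> t]
    expectation_poisson_pmf[OF _ _ poisson_power_sums, of \<mu> t]
  by (auto intro!: integrable_measure_pmf_finite)

lemma
  assumes "0 \<le> \<mu>"
  shows integrable_poisson_marginal: "integrable (measure_pmf (poisson_marginal \<mu>)) real"
    and expectation_poisson_marginal: "measure_pmf.expectation (poisson_marginal \<mu>) real = \<mu>"
  using assms integrable_poisson_pmf[OF _ _ poisson_mean_sums, of \<mu>]
    expectation_poisson_pmf[OF _ _ poisson_mean_sums, of \<mu>]
  by (auto intro!: integrable_measure_pmf_finite)

lemma
  assumes \<mu>: "\<And>j. j < M \<Longrightarrow> 0 \<le> \<mu> j" and j: "j < M"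
  shows integrable_poisson_law_component: "integrable (measure_pmf (poisson_law M \<mu>)) (\<lambda>y. real (y j))"
    and expectation_poisson_law_component: "measure_pmf.expectation (poisson_law M \<mu>) (\<lambda>y. real (y j)) = \<mu> j"
proof -
  have m: "map_pmf (\<lambda>y. y j) (poisson_law M \<mu>) = poisson_marginal (\<mu> j)"
    unfolding poisson_law_def using j by (subst Pi_pmf_component) auto
  show "integrable (measure_pmf (poisson_law M \<mu>)) (\<lambda>y. real (y j))"
    using integrable_poisson_marginal[OF \<mu>[OF j]] unfolding m[symmetric] by simp
  show "measure_pmf.expectation (poisson_law M \<mu>) (\<lambda>y. real (y j)) = \<mu> j"
    using expectation_poisson_marginal[OF \<mu>[OF j]] unfolding m[symmetric] by simp
qed

lemma poisson_law_support:
  assumes "y \<in> set_pmf (poisson_law M \<mu>)" "j < M" "\<mu> j = 0"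
  shows "y j = 0"
proof -
  have "map_pmf (\<lambda>y. y j) (poisson_law M \<mu>) = return_pmf 0"
    unfolding poisson_law_def using assms(2,3) by (subst Pi_pmf_component) auto
  then have "(\<lambda>y. y j) ` set_pmf (poisson_law M \<mu>) = {0}" by (metis set_map_pmf set_return_pmf)
  then show ?thesis using assms(1) by blast
qed

section \<open>Hellinger loss and likelihood ratios\<close>

text \<open>The squared distance of the root intensities, not of the laws: the affinity of the two
  product Poisson laws is \<open>exp (- hellinger2 M \<mu> \<nu> / 2)\<close>.\<close>

definition hellinger2 :: "nat \<Rightarrow> (nat \<Rightarrow> real) \<Rightarrow> (nat \<Rightarrow> real) \<Rightarrow> real" where
  "hellinger2 M \<mu> \<nu> = (\<Sum>j<M. (sqrt (\<mu> j) - sqrt (\<nu> j))\<^sup>2)"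

text \<open>The Kullback-Leibler divergence of product Poisson laws. A summand with
  \<open>\<mu> j = 0\<close> is \<open>\<nu> j\<close>, because the logarithm is multiplied by
  0.\<close>

definition poisson_kl :: "nat \<Rightarrow> (nat \<Rightarrow> real) \<Rightarrow> (nat \<Rightarrow> real) \<Rightarrow> real" where
  "poisson_kl M \<mu> \<nu> = (\<Sum>j<M. \<mu> j * ln (\<mu> j / \<nu> j) - \<mu> j + \<nu> j)"

text \<open>
  The square root of the likelihood ratio \<open>P\<^sub>\<nu> / P\<^sub>\<mu>\<close>. Where \<open>\<mu> j = 0\<close> the base is the junk value
  \<open>0\<close>, but then \<open>y j = 0\<close> almost surely.
\<close>

definition root_lr :: "nat \<Rightarrow> (nat \<Rightarrow> real) \<Rightarrow> (nat \<Rightarrow> real) \<Rightarrow> (nat \<Rightarrow> nat) \<Rightarrow> real" where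
  "root_lr M \<mu> \<nu> y = (\<Prod>j<M. sqrt (\<nu> j / \<mu> j) ^ y j * exp ((\<mu> j - \<nu> j) / 2))"

lemma hellinger2_nonneg: "0 \<le> hellinger2 M \<mu> \<nu>"
  unfolding hellinger2_def by (intro sum_nonneg) auto

text \<open>The expectation of the root likelihood ratio is the Hellinger affinity. It factors over
  the coordinates, and each factor is a generating function evaluated at
  \<open>sqrt (\<nu> j / \<mu> j)\<close>.\<close>

lemma
  assumes \<mu>: "\<And>j. j < M \<Longrightarrow> 0 \<le> \<mu> j" and \<nu>: "\<And>j. j < M \<Longrightarrow> 0 \<le> \<nu> j"
  shows integrable_root_lr: "integrable (measure_pmf (poisson_law M \<mu>)) (root_lr M \<mu> \<nu>)"
    and expectation_root_lr:
      "measure_pmf.expectation (poisson_law M \<mu>) (root_lr M \<mu> \<nu>) = exp (- hellinger2 M \<mu> \<nu> / 2)"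
proof -
  let ?f = "\<lambda>j y. sqrt (\<nu> j / \<mu> j) ^ y * exp ((\<mu> j - \<nu> j) / 2)"
  have int: "integrable (measure_pmf (poisson_marginal (\<mu> j))) (?f j)" if "j \<in> {..<M}" for j
    using that \<mu> \<nu> by (intro integrable_mult_left integrable_poisson_marginal_power) auto
  have E: "measure_pmf.expectation (poisson_marginal (\<mu> j)) (?f j) = exp (- (sqrt (\<mu> j) - sqrt (\<nu> j))\<^sup>2 / 2)"
    if "j \<in> {..<M}" for j
  proof -
    have nn: "0 \<le> \<mu> j" "0 \<le> \<nu> j" using that \<mu> \<nu> by auto
    have "measure_pmf.expectation (poisson_marginal (\<mu> j)) (?f j) =
        exp (\<mu> j * (sqrt (\<nu> j / \<mu> j) - 1)) * exp ((\<mu> j - \<nu> j) / 2)"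
      unfolding integral_mult_left_zero using nn by (subst expectation_poisson_marginal_power) auto
    also have "\<dots> = exp (- (sqrt (\<mu> j) - sqrt (\<nu> j))\<^sup>2 / 2)"
    proof -
      have "\<mu> j * sqrt (\<nu> j / \<mu> j) = sqrt (\<mu> j) * sqrt (\<nu> j)"
        using nn by (cases "\<mu> j = 0") (auto simp: real_sqrt_divide real_div_sqrt field_simps)
      then show ?thesis
        using nn by (simp add: exp_add[symmetric] power2_diff right_diff_distrib)
    qed
    finally show ?thesis .
  qed
  show "integrable (measure_pmf (poisson_law M \<mu>)) (root_lr M \<mu> \<nu>)"
    unfolding poisson_law_def root_lr_def[abs_def] using int by (intro integrable_prod_Pi_pmf) auto
  have "measure_pmf.expectation (poisson_law M \<mu>) (root_lr M \<mu> \<nu>) =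
      (\<Prod>j<M. measure_pmf.expectation (poisson_marginal (\<mu> j)) (?f j))"
    unfolding poisson_law_def root_lr_def[abs_def]
    by (rule expectation_prod_Pi_pmf) (use int \<mu> \<nu> in auto)
  also have "\<dots> = (\<Prod>j<M. exp (- (sqrt (\<mu> j) - sqrt (\<nu> j))\<^sup>2 / 2))"
    by (intro prod.cong refl E)
  also have "\<dots> = exp (- hellinger2 M \<mu> \<nu> / 2)"
    by (simp add: hellinger2_def exp_sum sum_divide_distrib flip: sum_negf)
  finally show "measure_pmf.expectation (poisson_law M \<mu>) (root_lr M \<mu> \<nu>) = exp (- hellinger2 M \<mu> \<nu> / 2)" .
qed

text \<open>The identities for the likelihood ratio are pointwise and restricted to observations
  that the truth can produce: a count is 0 wherever its true intensity is 0.\<close>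

context
  fixes M :: nat and \<mu> :: "nat \<Rightarrow> real" and y :: "nat \<Rightarrow> nat"
  assumes \<mu>: "\<And>j. j < M \<Longrightarrow> 0 \<le> \<mu> j"
    and y: "\<And>j. j < M \<Longrightarrow> \<mu> j = 0 \<Longrightarrow> y j = 0"
begin

lemma root_lr_pos:
  assumes "\<And>j. j < M \<Longrightarrow> 0 < \<nu> j"
  shows "0 < root_lr M \<mu> \<nu> y"
  unfolding root_lr_def
proof (intro prod_pos ballI mult_pos_pos)
  fix j assume "j \<in> {..<M}"
  then show "0 < sqrt (\<nu> j / \<mu> j) ^ y j"
    using \<mu>[of j] y[of j] assms[of j] by (cases "\<mu> j = 0") auto
qed auto

lemma ln_root_lr:
  assumes "\<And>j. j < M \<Longrightarrow> 0 < \<nu> j"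
  shows "ln (root_lr M \<mu> \<nu> y) = - (\<Sum>j<M. real (y j) * ln (\<mu> j / \<nu> j) - \<mu> j + \<nu> j) / 2"
proof -
  have "ln (root_lr M \<mu> \<nu> y) = (\<Sum>j<M. ln (sqrt (\<nu> j / \<mu> j) ^ y j * exp ((\<mu> j - \<nu> j) / 2)))"
    unfolding root_lr_def
  proof (rule ln_prod)
    fix j assume "j \<in> {..<M}"
    then show "sqrt (\<nu> j / \<mu> j) ^ y j * exp ((\<mu> j - \<nu> j) / 2) \<noteq> 0"
      using \<mu>[of j] y[of j] assms[of j] by (cases "\<mu> j = 0") auto
  qed simp
  also have "\<dots> = (\<Sum>j<M. - (real (y j) * ln (\<mu> j / \<nu> j) - \<mu> j + \<nu> j) / 2)"
  proof (intro sum.cong refl)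
    fix j assume "j \<in> {..<M}"
    then have j: "0 \<le> \<mu> j" "\<mu> j = 0 \<Longrightarrow> y j = 0" "0 < \<nu> j" using \<mu> y assms by auto
    show "ln (sqrt (\<nu> j / \<mu> j) ^ y j * exp ((\<mu> j - \<nu> j) / 2)) = - (real (y j) * ln (\<mu> j / \<nu> j) - \<mu> j + \<nu> j) / 2"
    proof (cases "\<mu> j = 0")
      case False
      then show ?thesis
        using j by (simp add: ln_mult ln_realpow ln_sqrt ln_div) (simp add: field_simps)
    qed (use j in simp)
  qed
  finally show ?thesis by (simp only: sum_negf flip: sum_divide_distrib)
qed

lemma poisson_lik_root_lr:
  assumes "\<And>j. j < M \<Longrightarrow> 0 < \<nu> j"
  shows "poisson_lik M \<nu> y = poisson_lik M \<mu> y * (root_lr M \<mu> \<nu> y)\<^sup>2"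
  unfolding poisson_lik_def root_lr_def prod_power_distrib prod.distrib[symmetric]
proof (intro prod.cong refl)
  fix j assume "j \<in> {..<M}"
  then have j: "0 \<le> \<mu> j" "\<mu> j = 0 \<Longrightarrow> y j = 0" "0 < \<nu> j" using \<mu> y assms by auto
  have e: "(exp ((\<mu> j - \<nu> j) / 2))\<^sup>2 = exp (\<mu> j - \<nu> j)"
    by (simp add: power2_eq_square flip: exp_add)
  show "\<nu> j ^ y j * exp (- \<nu> j) / fact (y j) =
      \<mu> j ^ y j * exp (- \<mu> j) / fact (y j) * (sqrt (\<nu> j / \<mu> j) ^ y j * exp ((\<mu> j - \<nu> j) / 2))\<^sup>2"
  proof (cases "\<mu> j = 0")
    case True
    then show ?thesis using j e by simp
  next
    case False
    have "(sqrt (\<nu> j / \<mu> j) ^ y j)\<^sup>2 = (\<nu> j / \<mu> j) ^ y j"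
      using j by (simp add: power_even_eq[symmetric] power_mult[symmetric] mult.commute[of _ 2] power_mult)
    then show ?thesis
      using False j unfolding power_mult_distrib e by (simp add: power_divide exp_diff exp_minus field_simps)
  qed
qed

lemma poisson_lik_truth_pos: "0 < poisson_lik M \<mu> y"
  unfolding poisson_lik_def
proof (intro prod_pos ballI)
  fix j assume "j \<in> {..<M}"
  then show "0 < \<mu> j ^ y j * exp (- \<mu> j) / fact (y j)"
    using \<mu>[of j] y[of j] by (cases "\<mu> j = 0") auto
qed

end

text \<open>
  The Li--Barron argument. With \<open>G = \<Sum>\<^sub>l exp (hellinger2 / 2 - pen l) \<surd>(P\<^sub>l / P\<^sub>\<mu>)\<close> the Kraft inequality
  gives \<open>E G \<le> 1\<close>, and \<open>G - 1 \<ge> ln G\<close> dominates half the loss of the estimator minus the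
  penalized log-likelihood ratio, which is largest at the estimator.
\<close>

lemma
  fixes \<nu> :: "'a \<Rightarrow> nat \<Rightarrow> real" and pen :: "'a \<Rightarrow> real" and est :: "(nat \<Rightarrow> nat) \<Rightarrow> 'a"
  assumes \<mu>: "\<And>j. j < M \<Longrightarrow> 0 \<le> \<mu> j" and \<nu>: "\<And>l j. l \<in> \<Lambda> \<Longrightarrow> j < M \<Longrightarrow> 0 < \<nu> l j"
    and fin: "finite \<Lambda>" and kraft: "(\<Sum>l\<in>\<Lambda>. exp (- pen l)) \<le> 1"
    and est: "\<And>y. est y \<in> \<Lambda>"
      "\<And>y l. l \<in> \<Lambda> \<Longrightarrow> - ln (poisson_lik M (\<nu> (est y)) y) + 2 * pen (est y) \<le> - ln (poisson_lik M (\<nu> l) y) + 2 * pen l"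
    and r: "r \<in> \<Lambda>"
  shows integrable_penalized_mle_hellinger2:
      "integrable (measure_pmf (poisson_law M \<mu>)) (\<lambda>y. hellinger2 M \<mu> (\<nu> (est y)))"
    and penalized_mle_hellinger_risk:
      "measure_pmf.expectation (poisson_law M \<mu>) (\<lambda>y. hellinger2 M \<mu> (\<nu> (est y)))
        \<le> poisson_kl M \<mu> (\<nu> r) + 2 * pen r"
proof -
  let ?P = "measure_pmf (poisson_law M \<mu>)"
  let ?H = "\<lambda>l. hellinger2 M \<mu> (\<nu> l)"
  define G where "G y = (\<Sum>l\<in>\<Lambda>. exp (?H l / 2 - pen l) * root_lr M \<mu> (\<nu> l) y)" for y
  define ell where "ell y = (\<Sum>j<M. real (y j) * ln (\<mu> j / \<nu> r j) - \<mu> j + \<nu> r j)" for y :: "nat \<Rightarrow> nat"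
  have \<nu>': "\<And>l j. l \<in> \<Lambda> \<Longrightarrow> j < M \<Longrightarrow> 0 \<le> \<nu> l j" using \<nu> less_imp_le by blast
  have int_G: "integrable ?P G"
    unfolding G_def[abs_def] using \<mu> \<nu>'
    by (intro Bochner_Integration.integrable_sum integrable_mult_right integrable_root_lr) auto
  have "(\<integral>y. G y \<partial>?P) = (\<Sum>l\<in>\<Lambda>. exp (?H l / 2 - pen l) * exp (- ?H l / 2))"
    unfolding G_def using \<mu> \<nu>'
    by (subst Bochner_Integration.integral_sum)
       (auto intro!: integrable_mult_right integrable_root_lr sum.cong simp: expectation_root_lr)
  \<comment> \<open>The weight \<open>exp (hellinger2 / 2)\<close> in \<open>G\<close> cancels the
    affinity exactly and leaves the Kraft sum.\<close>
  also have "\<dots> \<le> 1" using kraft by (simp add: flip: exp_add)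
  finally have E_G: "(\<integral>y. G y \<partial>?P) \<le> 1" .
  have int_j: "integrable ?P (\<lambda>y. real (y j) * ln (\<mu> j / \<nu> r j) - \<mu> j + \<nu> r j)" if "j < M" for j
    using \<mu> that
    by (intro Bochner_Integration.integrable_add Bochner_Integration.integrable_diff
        integrable_mult_left integrable_poisson_law_component) auto
  have int_ell: "integrable ?P ell"
    unfolding ell_def[abs_def] using int_j by (intro Bochner_Integration.integrable_sum) auto
  have E_ell: "(\<integral>y. ell y \<partial>?P) = poisson_kl M \<mu> (\<nu> r)"
    unfolding ell_def poisson_kl_def
  proof (subst Bochner_Integration.integral_sum)
    show "(\<Sum>j<M. \<integral>y. real (y j) * ln (\<mu> j / \<nu> r j) - \<mu> j + \<nu> r j \<partial>?P) =
        (\<Sum>j<M. \<mu> j * ln (\<mu> j / \<nu> r j) - \<mu> j + \<nu> r j)"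
    proof (intro sum.cong refl)
      fix j assume "j \<in> {..<M}"
      then have j: "j < M" by simp
      show "(\<integral>y. real (y j) * ln (\<mu> j / \<nu> r j) - \<mu> j + \<nu> r j \<partial>?P) = \<mu> j * ln (\<mu> j / \<nu> r j) - \<mu> j + \<nu> r j"
        using integrable_poisson_law_component[OF \<mu> j] expectation_poisson_law_component[OF \<mu> j]
        by (simp add: measure_pmf.prob_space)
    qed
  qed (use int_j in auto)
  have bound: "?H (est y) \<le> 2 * (G y - 1) + 2 * pen r + ell y" if "y \<in> set_pmf (poisson_law M \<mu>)" for y
  proof -
    have y: "\<And>j. j < M \<Longrightarrow> \<mu> j = 0 \<Longrightarrow> y j = 0" using poisson_law_support[OF that] by blast
    note facts = \<mu> y
    have pos: "0 < root_lr M \<mu> (\<nu> l) y" if "l \<in> \<Lambda>" for l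
      using facts \<nu> that by (intro root_lr_pos) auto
    have ln_lik: "ln (poisson_lik M (\<nu> l) y) = ln (poisson_lik M \<mu> y) + 2 * ln (root_lr M \<mu> (\<nu> l) y)" if "l \<in> \<Lambda>" for l
    proof -
      have "poisson_lik M (\<nu> l) y = poisson_lik M \<mu> y * (root_lr M \<mu> (\<nu> l) y)\<^sup>2"
        using facts \<nu> that by (intro poisson_lik_root_lr) auto
      moreover have "0 < poisson_lik M \<mu> y" using facts by (intro poisson_lik_truth_pos) auto
      ultimately show ?thesis using pos[OF that] by (simp add: ln_mult ln_realpow)
    qed
    have "ln (root_lr M \<mu> (\<nu> r) y) = - ell y / 2"
      unfolding ell_def using facts \<nu> r by (intro ln_root_lr) auto
    \<comment> \<open>Minimality of the estimator against the fixed candidate \<open>r\<close>; the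
      likelihood of the truth cancels from both sides.\<close>
    then have "- ell y / 2 - pen r \<le> ln (root_lr M \<mu> (\<nu> (est y)) y) - pen (est y)"
      using est(2)[OF r, of y] ln_lik[OF r] ln_lik[OF est(1)[of y]] by simp
    moreover have "1 + (?H (est y) / 2 - pen (est y) + ln (root_lr M \<mu> (\<nu> (est y)) y)) \<le>
        exp (?H (est y) / 2 - pen (est y)) * root_lr M \<mu> (\<nu> (est y)) y"
      using exp_ge_add_one_self[of "?H (est y) / 2 - pen (est y) + ln (root_lr M \<mu> (\<nu> (est y)) y)"]
        pos[OF est(1)[of y]] by (simp add: exp_add)
    moreover have "\<dots> \<le> G y"
      unfolding G_def using fin est(1)[of y] pos
      by (intro member_le_sum) (auto intro: less_imp_le)
    ultimately show ?thesis by (simp add: field_simps)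
  qed
  \<comment> \<open>The estimator ranges over a finite class, so its loss is bounded and hence
    integrable.\<close>
  have H_le: "norm (?H (est y)) \<le> (\<Sum>l\<in>\<Lambda>. ?H l)" for y
    using member_le_sum[of "est y" \<Lambda> ?H] est(1) fin by (simp add: hellinger2_nonneg)
  show int_H: "integrable ?P (\<lambda>y. ?H (est y))"
    by (rule measure_pmf.integrable_const_bound[where B = "\<Sum>l\<in>\<Lambda>. ?H l"]) (use H_le in auto)
  have "(\<integral>y. ?H (est y) \<partial>?P) \<le> (\<integral>y. 2 * (G y - 1) + 2 * pen r + ell y \<partial>?P)"
    using int_H int_G int_ell bound by (intro integral_mono_AE) (auto simp: AE_measure_pmf_iff)
  also have "\<dots> = 2 * ((\<integral>y. G y \<partial>?P) - 1) + 2 * pen r + (\<integral>y. ell y \<partial>?P)"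
    using int_G int_ell by (simp add: measure_pmf.prob_space)
  also have "\<dots> \<le> poisson_kl M \<mu> (\<nu> r) + 2 * pen r"
    using E_G E_ell by simp
  finally show "(\<integral>y. ?H (est y) \<partial>?P) \<le> poisson_kl M \<mu> (\<nu> r) + 2 * pen r" .
qed

section \<open>Comparison of divergences\<close>

text \<open>From \<open>ln x \<le> x - 1\<close> with \<open>x = \<mu> j / \<nu> j\<close>.\<close>

lemma poisson_kl_le_chi_square:
  assumes "\<And>j. j < M \<Longrightarrow> 0 \<le> \<mu> j" "\<And>j. j < M \<Longrightarrow> 0 < \<nu> j"
  shows "poisson_kl M \<mu> \<nu> \<le> (\<Sum>j<M. (\<mu> j - \<nu> j)\<^sup>2 / \<nu> j)"
  unfolding poisson_kl_def
proof (intro sum_mono)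
  fix j assume "j \<in> {..<M}"
  then have j: "0 \<le> \<mu> j" "0 < \<nu> j" using assms by auto
  have "\<mu> j * ln (\<mu> j / \<nu> j) \<le> \<mu> j * (\<mu> j / \<nu> j - 1)"
    using j ln_le_minus_one[of "\<mu> j / \<nu> j"] by (cases "\<mu> j = 0") (auto intro!: mult_left_mono)
  also have "\<dots> = (\<mu> j - \<nu> j)\<^sup>2 / \<nu> j + \<mu> j - \<nu> j"
    using j by (simp add: field_simps power2_eq_square)
  finally show "\<mu> j * ln (\<mu> j / \<nu> j) - \<mu> j + \<nu> j \<le> (\<mu> j - \<nu> j)\<^sup>2 / \<nu> j" by simp
qed

text \<open>A difference is the product of the difference and the sum of the roots, and the
  arithmetic-geometric inequality separates the two factors. The free weight \<open>q\<close> keeps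
  the bound linear in \<open>hellinger2\<close>, so that expectations can be taken.\<close>

lemma norm1_diff_le_hellinger2:
  assumes \<mu>: "\<And>j. j < M \<Longrightarrow> 0 \<le> \<mu> j" and \<nu>: "\<And>j. j < M \<Longrightarrow> 0 \<le> \<nu> j" and q: "q > 0"
  shows "norm1 M (\<lambda>j. \<mu> j - \<nu> j) \<le> q * (norm1 M \<mu> + norm1 M \<nu>) + hellinger2 M \<mu> \<nu> / (2 * q)"
  unfolding norm1_def hellinger2_def sum.distrib[symmetric] sum_distrib_left sum_divide_distrib
proof (intro sum_mono)
  fix j assume "j \<in> {..<M}"
  then have nn: "0 \<le> \<mu> j" "0 \<le> \<nu> j" using assms by auto
  define a b where "a = \<bar>sqrt (\<mu> j) - sqrt (\<nu> j)\<bar>" and "b = sqrt (\<mu> j) + sqrt (\<nu> j)"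
  have "\<mu> j - \<nu> j = (sqrt (\<mu> j) - sqrt (\<nu> j)) * b"
    using nn by (simp add: b_def algebra_simps)
  then have "\<bar>\<mu> j - \<nu> j\<bar> = a * b" using nn by (simp add: abs_mult a_def b_def)
  also have "a * b \<le> q * b\<^sup>2 / 2 + a\<^sup>2 / (2 * q)"
  proof -
    have "0 \<le> (q * b - a)\<^sup>2" by simp
    then have "2 * q * (a * b) \<le> q * (q * b\<^sup>2) + a\<^sup>2" by (simp add: power2_eq_square algebra_simps)
    then show ?thesis using q by (simp add: field_simps power2_eq_square)
  qed
  also have "b\<^sup>2 \<le> 2 * (\<mu> j + \<nu> j)"
  proof -
    have "b\<^sup>2 + (sqrt (\<mu> j) - sqrt (\<nu> j))\<^sup>2 = 2 * (\<mu> j + \<nu> j)"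
      using nn by (simp add: b_def power2_sum power2_diff)
    then show ?thesis by (metis le_add_same_cancel1 zero_le_power2)
  qed
  finally show "\<bar>\<mu> j - \<nu> j\<bar> \<le> q * (\<bar>\<mu> j\<bar> + \<bar>\<nu> j\<bar>) + (sqrt (\<mu> j) - sqrt (\<nu> j))\<^sup>2 / (2 * q)"
    using q nn by (simp add: a_def field_simps)
qed

subsection \<open>The counting experiment\<close>

lemma mat_app_diff: "mat_app N B (\<lambda>i. u i - v i) j = mat_app N B u j - mat_app N B v j"
  by (simp add: mat_app_def right_diff_distrib sum_subtractf)

lemma norm1_triangle_scaled:
  "norm1 M (\<lambda>j. s * u j + b * v j) \<le> \<bar>s\<bar> * norm1 M u + \<bar>b\<bar> * norm1 M v"
  unfolding norm1_def sum_distrib_left sum.distrib[symmetric]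
  by (intro sum_mono) (metis abs_mult abs_triangle_ineq)

text \<open>Here \<open>T\<close> is the observation time \<open>n\<tau>\<close>, and the assumption
  \<open>pmle\<close> is the unfolded form of \<open>is_pmle\<close>.\<close>

locale counting_experiment = expander_graph k "1 / 16" N M d E for k N M d E +
  fixes \<Omega> :: "nat set" and T L0 \<delta> c :: real
    and pen :: "(nat \<Rightarrow> real) \<Rightarrow> real" and est :: "(nat \<Rightarrow> nat) \<Rightarrow> nat \<Rightarrow> real"
  assumes cover: "covering_set N M E \<Omega>"
    and T_pos: "T > 0" and L0_pos: "L0 > 0" and c_pos: "c > 0"
    and kraft: "(\<Sum>l\<in>quantized_class N L0 \<delta>. exp (- pen l)) \<le> 1"
    and pmle: "\<And>y. \<exists>f. is_arg_min
        (\<lambda>f. - ln (poisson_lik M (mat_app N \<Phi> f) y) + 2 * pen (unshift (T * real d) (c * (T * real d * L0)) \<Omega> f))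
        (\<lambda>f. f \<in> shifted_class (T * real d) (c * (T * real d * L0)) \<Omega> (quantized_class N L0 \<delta>)) f \<and>
        est y = unshift (T * real d) (c * (T * real d * L0)) \<Omega> f"
begin

definition scale :: real where "scale = T * real d"

definition shift :: real where "shift = c * (T * real d * L0)"

definition cover_load :: "nat \<Rightarrow> real" where
  "cover_load j = mat_app N \<Phi> (indicator \<Omega>) j"

definition truth :: "(nat \<Rightarrow> real) \<Rightarrow> nat \<Rightarrow> real" where
  "truth l j = scale * mat_app N \<Phi> l j"

definition intensity :: "(nat \<Rightarrow> real) \<Rightarrow> nat \<Rightarrow> real" where
  "intensity l j = scale * mat_app N \<Phi> l j + shift * cover_load j"

lemma scale_pos: "scale > 0" and shift_pos: "shift > 0"
  using T_pos L0_pos c_pos d_pos by (auto simp: scale_def shift_def)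

lemma shift_eq: "shift = c * scale * L0"
  by (simp add: shift_def scale_def)

lemma truth_eq: "truth l = (\<lambda>j. T * mat_app N (adj_matrix E) l j)"
  using d_pos by (auto simp: truth_def scale_def mat_app_def \<Phi>_def fun_eq_iff simp flip: sum_divide_distrib)

lemma quantized_classD:
  assumes "l \<in> quantized_class N L0 \<delta>"
  shows "0 \<le> l i" "norm1 N l \<le> L0"
  using assms by (auto simp: quantized_class_def nonneg_vecs_def)

lemma mat_app_\<Phi>_nonneg: "(\<And>i. 0 \<le> u i) \<Longrightarrow> 0 \<le> mat_app N \<Phi> u j"
  unfolding mat_app_def by (intro sum_nonneg mult_nonneg_nonneg \<Phi>_nonneg) auto

lemma norm1_mat_app_\<Phi>: "(\<And>i. 0 \<le> u i) \<Longrightarrow> norm1 M (mat_app N \<Phi> u) = norm1 N u"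
  using sum_mat_app_\<Phi>[of u] mat_app_\<Phi>_nonneg[of u] by (simp add: norm1_def)

text \<open>Every right vertex has a neighbor in \<Omega>, which contributes the entry
  \<open>1 / d\<close>.\<close>

lemma cover_load_ge: "j < M \<Longrightarrow> 1 / real d \<le> cover_load j"
proof -
  assume "j < M"
  then obtain i where i: "i \<in> \<Omega>" "(i, j) \<in> E" using cover by (auto simp: covering_set_def)
  then have "i < N" using edge_bounds by auto
  then have "\<Phi> j i * indicator \<Omega> i \<le> (\<Sum>i<N. \<Phi> j i * indicator \<Omega> i)"
    by (intro member_le_sum mult_nonneg_nonneg \<Phi>_nonneg) auto
  then show ?thesis using i by (simp add: cover_load_def mat_app_def \<Phi>_def adj_matrix_def)
qed

lemma cover_load_nonneg: "0 \<le> cover_load j"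
  unfolding cover_load_def by (intro mat_app_\<Phi>_nonneg) auto

lemma sum_cover_load: "(\<Sum>j<M. cover_load j) \<le> real M"
proof -
  have "\<Omega> \<subseteq> {..<N}" "card \<Omega> \<le> M" using cover by (auto simp: covering_set_def)
  moreover from this have "(\<Sum>i<N. indicator \<Omega> i) = (\<Sum>i\<in>\<Omega>. 1 :: real)"
    by (intro sum.mono_neutral_cong_right) auto
  ultimately show ?thesis by (simp add: cover_load_def sum_mat_app_\<Phi>)
qed

lemma norm1_cover_load: "norm1 M cover_load \<le> real M"
  using sum_cover_load cover_load_nonneg by (simp add: norm1_def)

lemma intensity_ge:
  assumes "l \<in> quantized_class N L0 \<delta>"
  shows "shift * cover_load j \<le> intensity l j"
  using mat_app_\<Phi>_nonneg[of l j] quantized_classD(1)[OF assms] scale_pos by (simp add: intensity_def)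

lemma intensity_pos:
  assumes "l \<in> quantized_class N L0 \<delta>" "j < M"
  shows "0 < intensity l j"
proof -
  have "0 < 1 / real d" using d_pos by simp
  then have "0 < cover_load j" using cover_load_ge[OF assms(2)] by linarith
  then have "0 < shift * cover_load j" using shift_pos by simp
  then show ?thesis using intensity_ge[OF assms(1), of j] by simp
qed

text \<open>A change of variables: \<open>lift\<close> maps the quantized class onto the shifted one
  and is undone by \<open>unshift\<close>, so the estimator itself minimizes over the quantized
  class.\<close>

lemma
  shows est_class: "est y \<in> quantized_class N L0 \<delta>"
    and est_minimal: "l \<in> quantized_class N L0 \<delta> \<Longrightarrow>
      - ln (poisson_lik M (intensity (est y)) y) + 2 * pen (est y) \<le> - ln (poisson_lik M (intensity l) y) + 2 * pen l"
proof -
  define lift where "lift l i = scale * l i + shift * indicator \<Omega> i" for l :: "nat \<Rightarrow> real" and i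
  have unshift_lift: "unshift scale shift \<Omega> (lift l) = l" for l
    using scale_pos by (simp add: unshift_def lift_def)
  have mat_lift: "mat_app N \<Phi> (lift l) = intensity l" for l
  proof
    fix j
    have "mat_app N \<Phi> (lift l) j = (\<Sum>i<N. scale * (\<Phi> j i * l i) + shift * (\<Phi> j i * indicator \<Omega> i))"
      unfolding mat_app_def lift_def by (intro sum.cong) (auto simp: algebra_simps)
    then show "mat_app N \<Phi> (lift l) j = intensity l j"
      by (simp only: intensity_def cover_load_def mat_app_def sum.distrib sum_distrib_left)
  qed
  have class_lift: "shifted_class scale shift \<Omega> (quantized_class N L0 \<delta>) = lift ` quantized_class N L0 \<delta>"
    by (auto simp: shifted_class_def lift_def[abs_def])
  obtain f where f: "is_arg_min
        (\<lambda>f. - ln (poisson_lik M (mat_app N \<Phi> f) y) + 2 * pen (unshift scale shift \<Omega> f))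
        (\<lambda>f. f \<in> shifted_class scale shift \<Omega> (quantized_class N L0 \<delta>)) f" "est y = unshift scale shift \<Omega> f"
    using pmle[of y] unfolding shift_def[symmetric] unfolding scale_def[symmetric] by auto
  then obtain l0 where l0: "l0 \<in> quantized_class N L0 \<delta>" "f = lift l0"
    unfolding is_arg_min_def class_lift by auto
  have e: "est y = l0" using f(2) l0(2) unshift_lift by simp
  then show "est y \<in> quantized_class N L0 \<delta>" using l0 by simp
  show "- ln (poisson_lik M (intensity (est y)) y) + 2 * pen (est y) \<le> - ln (poisson_lik M (intensity l) y) + 2 * pen l"
    if "l \<in> quantized_class N L0 \<delta>"
    using f(1) that unfolding is_arg_min_linorder class_lift l0(2) e by (auto simp: mat_lift unshift_lift)
qed

text \<open>The chi-square numerator splits into approximation error and shift. The first part is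
  divided by the uniform bound \<open>shift / d\<close>, the second by its own size
  \<open>shift * cover_load j\<close>, so that the shift contributes only linearly.\<close>

lemma poisson_kl_intensity_le:
  assumes l: "\<And>i. 0 \<le> l i" and r: "r \<in> quantized_class N L0 \<delta>"
  shows "poisson_kl M (truth l) (intensity r) \<le>
    scale * (2 * real d / (c * L0) * (\<Sum>j<M. (mat_app N \<Phi> (\<lambda>i. l i - r i) j)\<^sup>2) + 2 * c * L0 * real M)"
proof -
  let ?u = "\<lambda>j. mat_app N \<Phi> (\<lambda>i. l i - r i) j"
  have "poisson_kl M (truth l) (intensity r) \<le> (\<Sum>j<M. (truth l j - intensity r j)\<^sup>2 / intensity r j)"
    using l r mat_app_\<Phi>_nonneg[of l] scale_pos intensity_pos
    by (intro poisson_kl_le_chi_square) (auto simp: truth_def)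
  also have "\<dots> \<le> (\<Sum>j<M. 2 * (scale\<^sup>2 * real d / shift * (?u j)\<^sup>2) + 2 * (shift * cover_load j))"
  proof (intro sum_mono)
    fix j assume "j \<in> {..<M}"
    then have j: "j < M" by simp
    define v where "v = intensity r j"
    have v: "shift * cover_load j \<le> v" "0 < v"
      using intensity_ge[OF r] intensity_pos[OF r j] by (auto simp: v_def)
    have load: "0 < cover_load j" "shift / real d \<le> shift * cover_load j"
    proof -
      have "0 < 1 / real d" using d_pos by simp
      then show "0 < cover_load j" using cover_load_ge[OF j] by linarith
      show "shift / real d \<le> shift * cover_load j"
        using mult_left_mono[OF cover_load_ge[OF j], of shift] shift_pos by simp
    qed
    have "(truth l j - intensity r j)\<^sup>2 = (scale * ?u j + - (shift * cover_load j))\<^sup>2"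
      by (simp add: truth_def intensity_def mat_app_diff algebra_simps)
    also have "\<dots> \<le> 2 * (scale * ?u j)\<^sup>2 + 2 * (shift * cover_load j)\<^sup>2"
      using square_sum_le[of "scale * ?u j" "- (shift * cover_load j)"] by simp
    finally have "(truth l j - intensity r j)\<^sup>2 / v \<le> 2 * ((scale * ?u j)\<^sup>2 / v) + 2 * ((shift * cover_load j)\<^sup>2 / v)"
      using v by (simp add: field_simps)
    moreover have "(scale * ?u j)\<^sup>2 / v \<le> (scale * ?u j)\<^sup>2 / (shift / real d)"
      using v load shift_pos d_pos by (intro divide_left_mono) auto
    moreover have "(shift * cover_load j)\<^sup>2 / v \<le> (shift * cover_load j)\<^sup>2 / (shift * cover_load j)"
      using v load shift_pos by (intro divide_left_mono) auto
    moreover have "(scale * ?u j)\<^sup>2 / (shift / real d) = scale\<^sup>2 * real d / shift * (?u j)\<^sup>2"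
      by (simp add: power_mult_distrib)
    moreover have "(shift * cover_load j)\<^sup>2 / (shift * cover_load j) = shift * cover_load j"
      by (simp add: power2_eq_square)
    ultimately show "(truth l j - intensity r j)\<^sup>2 / intensity r j \<le>
        2 * (scale\<^sup>2 * real d / shift * (?u j)\<^sup>2) + 2 * (shift * cover_load j)"
      unfolding v_def by linarith
  qed
  also have "\<dots> = 2 * (scale\<^sup>2 * real d / shift) * (\<Sum>j<M. (?u j)\<^sup>2) + 2 * shift * (\<Sum>j<M. cover_load j)"
  proof -
    have "(\<Sum>j<M. 2 * (a * f j) + 2 * (b * g j)) = 2 * a * (\<Sum>j<M. f j) + 2 * b * (\<Sum>j<M. g j)"
      for a b :: real and f g
      by (simp add: sum.distrib sum_distrib_left mult_ac)
    then show ?thesis .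
  qed
  also have "\<dots> \<le> 2 * (scale\<^sup>2 * real d / shift) * (\<Sum>j<M. (?u j)\<^sup>2) + 2 * shift * real M"
    using sum_cover_load shift_pos by simp
  also have "scale\<^sup>2 * real d / shift = scale * (real d / (c * L0))"
    using scale_pos c_pos L0_pos by (simp add: shift_eq field_simps power2_eq_square)
  finally show ?thesis by (simp add: shift_eq algebra_simps)
qed

text \<open>The expander estimate reduces the loss to the measurement error. There the triangle
  inequality removes the shift, at the price \<open>c * L0 * M\<close>, and the rest is bounded by
  the Hellinger loss.\<close>

lemma norm1_est_diff_le:
  assumes m: "1 \<le> m" "2 * m \<le> k" "m \<le> N" and q: "q > 0"
    and l: "l \<in> nonneg_vecs N" "norm1 N l \<le> L0"
  shows "norm1 N (\<lambda>i. est y i - l i) \<le>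
    5 * (q * L0 * (2 + c * real M) + hellinger2 M (truth l) (intensity (est y)) / (2 * q * scale) + c * L0 * real M)
      + 3 * best_approx_err N m l"
proof -
  let ?D = "norm1 M (mat_app N \<Phi> (\<lambda>i. est y i - l i))"
  have l0: "0 \<le> l i" for i using l by (simp add: nonneg_vecs_def)
  have e: "est y \<in> quantized_class N L0 \<delta>" by (rule est_class)
  have sM: "shift * norm1 M cover_load \<le> shift * real M"
    using norm1_cover_load shift_pos by simp
  have eq: "scale * mat_app N \<Phi> (\<lambda>i. est y i - l i) j = - 1 * (truth l j - intensity (est y) j) + - shift * cover_load j" for j
    by (simp add: truth_def intensity_def mat_app_diff algebra_simps)
  have "scale * ?D = norm1 M (\<lambda>j. scale * mat_app N \<Phi> (\<lambda>i. est y i - l i) j)"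
    using scale_pos by (simp add: norm1_def sum_distrib_left abs_mult)
  also have "\<dots> = norm1 M (\<lambda>j. - 1 * (truth l j - intensity (est y) j) + - shift * cover_load j)"
    by (simp only: eq)
  also have "\<dots> \<le> norm1 M (\<lambda>j. truth l j - intensity (est y) j) + shift * norm1 M cover_load"
    using norm1_triangle_scaled[of M "- 1" "\<lambda>j. truth l j - intensity (est y) j" "- shift" cover_load] shift_pos by simp
  also have "norm1 M (\<lambda>j. truth l j - intensity (est y) j) \<le>
      q * (norm1 M (truth l) + norm1 M (intensity (est y))) + hellinger2 M (truth l) (intensity (est y)) / (2 * q)"
    using q mat_app_\<Phi>_nonneg[of l] l0 scale_pos intensity_pos[OF e]
    by (intro norm1_diff_le_hellinger2) (auto simp: truth_def less_imp_le)
  also have "norm1 M (truth l) \<le> scale * L0"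
  proof -
    have "norm1 M (truth l) = scale * norm1 M (mat_app N \<Phi> l)"
      using scale_pos by (simp add: truth_def norm1_def abs_mult sum_distrib_left)
    also have "\<dots> \<le> scale * L0" using l l0 scale_pos by (simp add: norm1_mat_app_\<Phi>)
    finally show ?thesis .
  qed
  also have "norm1 M (intensity (est y)) \<le> scale * L0 + shift * real M"
  proof -
    have "norm1 M (intensity (est y)) \<le> scale * norm1 M (mat_app N \<Phi> (est y)) + shift * norm1 M cover_load"
      using norm1_triangle_scaled[of M scale "mat_app N \<Phi> (est y)" shift cover_load] scale_pos shift_pos
      by (simp add: intensity_def[abs_def])
    also have "scale * norm1 M (mat_app N \<Phi> (est y)) \<le> scale * L0"
      using quantized_classD[OF e] scale_pos by (simp add: norm1_mat_app_\<Phi>)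
    finally show ?thesis using sM by simp
  qed
  finally have "scale * ?D \<le> q * (scale * L0 + (scale * L0 + shift * real M)) +
      hellinger2 M (truth l) (intensity (est y)) / (2 * q) + shift * norm1 M cover_load"
    using q by simp
  also have "\<dots> \<le> q * (scale * L0 + (scale * L0 + shift * real M)) +
      hellinger2 M (truth l) (intensity (est y)) / (2 * q) + shift * real M"
    using sM by simp
  also have "\<dots> = scale * (q * L0 * (2 + c * real M) + hellinger2 M (truth l) (intensity (est y)) / (2 * q * scale) + c * L0 * real M)"
    using scale_pos q by (simp add: shift_eq field_simps)
  finally have D: "?D \<le> q * L0 * (2 + c * real M) + hellinger2 M (truth l) (intensity (est y)) / (2 * q * scale) + c * L0 * real M"
    using scale_pos by simp
  have "norm1 N (\<lambda>i. est y i - l i) \<le> 5 * ?D + 3 * best_approx_err N m l"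
    using l0 quantized_classD[OF e] m by (intro norm1_diff_le_measurements) auto
  also note D
  finally show ?thesis by simp
qed

text \<open>Two sparsity levels occur independently: \<open>m\<close> is limited by the expander,
  whereas \<open>n\<close> belongs to the candidate \<open>r\<close> and is free up to
  \<open>N\<close>. The number \<open>W\<close> bounds the Hellinger risk per unit of
  \<open>scale\<close>.\<close>

lemma risk_le:
  assumes m: "1 \<le> m" "2 * m \<le> k" "m \<le> N"
    and l: "l \<in> nonneg_vecs N" "norm1 N l \<le> L0"
    and \<delta>: "0 < \<delta>" "L0 / sqrt \<delta> \<in> \<nat>" and n: "1 \<le> n" "n \<le> N"
    and pen: "\<And>r. r \<in> quantized_class N L0 \<delta> \<Longrightarrow> r \<noteq> (\<lambda>_. 0) \<Longrightarrow> pen r \<le> Q * real (norm0 N r)"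
    and Q: "Q \<ge> 0" and W: "W > 0"
      "2 / (c * L0) * (2 * (best_approx_err N n l)\<^sup>2 + 12 * real n * \<delta>) + 2 * c * L0 * real M + 2 * Q * real n / T \<le> W"
  shows "(\<integral>\<^sup>+ y. ennreal (norm1 N (\<lambda>i. est y i - l i)) \<partial>measure_pmf (poisson_law M (\<lambda>j. T * mat_app N (adj_matrix E) l j)))
    \<le> ennreal (5 * (sqrt W * (L0 * (2 + c * real M) + 1 / 2) + c * L0 * real M) + 3 * best_approx_err N m l)"
proof -
  let ?P = "measure_pmf (poisson_law M (truth l))"
  let ?H = "\<lambda>y. hellinger2 M (truth l) (intensity (est y))"
  have l0: "0 \<le> l i" for i using l by (simp add: nonneg_vecs_def)
  obtain r where r: "r \<in> quantized_class N L0 \<delta>" "r \<noteq> (\<lambda>_. 0)" "norm0 N r \<le> n"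
    "(\<Sum>j<M. (mat_app N \<Phi> (\<lambda>i. l i - r i) j)\<^sup>2) \<le> 1 / real d * (2 * (best_approx_err N n l)\<^sup>2 + 12 * real n * \<delta>)"
  proof (rule quantized_approximation[where B = \<Phi> and M = M and \<kappa> = "1 / real d", OF _ _ l L0_pos \<delta> n])
    show "0 \<le> \<Phi> j i" for j i by (rule \<Phi>_nonneg)
    show "(\<Sum>j<M. (\<Phi> j i)\<^sup>2) \<le> 1 / real d" if "i < N" for i
      using sum_\<Phi>_column_square[OF that] by simp
  qed (rule that)
  have truth_nonneg: "0 \<le> truth l j" for j
    using mat_app_\<Phi>_nonneg[of l] l0 scale_pos by (simp add: truth_def)
  have int: "integrable ?P ?H"
    by (rule integrable_penalized_mle_hellinger2[OF truth_nonneg intensity_pos finite_quantized_class kraft est_class est_minimal r(1)])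
  have "(\<integral>y. ?H y \<partial>?P) \<le> poisson_kl M (truth l) (intensity r) + 2 * pen r"
    by (rule penalized_mle_hellinger_risk[OF truth_nonneg intensity_pos finite_quantized_class kraft est_class est_minimal r(1)])
  also have "poisson_kl M (truth l) (intensity r) \<le>
      scale * (2 * real d / (c * L0) * (1 / real d * (2 * (best_approx_err N n l)\<^sup>2 + 12 * real n * \<delta>)) + 2 * c * L0 * real M)"
  proof -
    have "scale * (2 * real d / (c * L0) * (\<Sum>j<M. (mat_app N \<Phi> (\<lambda>i. l i - r i) j)\<^sup>2) + 2 * c * L0 * real M) \<le>
        scale * (2 * real d / (c * L0) * (1 / real d * (2 * (best_approx_err N n l)\<^sup>2 + 12 * real n * \<delta>)) + 2 * c * L0 * real M)"
      using scale_pos c_pos L0_pos by (intro mult_left_mono add_right_mono r(4)) auto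
    with poisson_kl_intensity_le[OF l0 r(1)] show ?thesis by (rule order_trans)
  qed
  \<comment> \<open>The degree from the lower bound on the intensities cancels against the squared
    column norm \<open>1 / d\<close>.\<close>
  also have "2 * real d / (c * L0) * (1 / real d * (2 * (best_approx_err N n l)\<^sup>2 + 12 * real n * \<delta>)) =
      2 / (c * L0) * (2 * (best_approx_err N n l)\<^sup>2 + 12 * real n * \<delta>)"
    using d_pos by simp
  also have "pen r \<le> scale * (Q * real n / T)"
  proof -
    have "pen r \<le> Q * real (norm0 N r)" using pen r by blast
    also have "\<dots> \<le> Q * real n" using r(3) Q by (intro mult_left_mono) auto
    also have "\<dots> \<le> real d * (Q * real n)" using mult_right_mono[of 1 "real d" "Q * real n"] d_pos Q by simp
    also have "\<dots> = scale * (Q * real n / T)" using T_pos by (simp add: scale_def)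
    finally show ?thesis .
  qed
  finally have "(\<integral>y. ?H y \<partial>?P) \<le> scale * (2 / (c * L0) * (2 * (best_approx_err N n l)\<^sup>2 + 12 * real n * \<delta>)
      + 2 * c * L0 * real M + 2 * Q * real n / T)"
    by (simp add: distrib_left mult_ac)
  also have "\<dots> \<le> scale * W" using W scale_pos by (intro mult_left_mono) auto
  finally have E_H: "(\<integral>y. ?H y \<partial>?P) \<le> scale * W" .
  \<comment> \<open>This weight balances the terms of order \<open>q\<close> and
    \<open>W / q\<close>.\<close>
  define q where "q = sqrt W"
  have q: "q > 0" using W by (simp add: q_def)
  define A where "A = 5 * (q * L0 * (2 + c * real M) + c * L0 * real M) + 3 * best_approx_err N m l"
  define b where "b = 5 / (2 * q * scale)"
  have b: "0 \<le> b" using q scale_pos by (simp add: b_def)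
  have "norm1 N (\<lambda>i. est y i - l i) \<le> A + b * ?H y" for y
    using norm1_est_diff_le[OF m q l, of y] by (simp add: A_def b_def algebra_simps)
  then have "(\<integral>\<^sup>+ y. ennreal (norm1 N (\<lambda>i. est y i - l i)) \<partial>?P) \<le> (\<integral>\<^sup>+ y. ennreal (A + b * ?H y) \<partial>?P)"
    by (intro nn_integral_mono ennreal_leI)
  also have "\<dots> = ennreal (\<integral>y. A + b * ?H y \<partial>?P)"
  proof (rule nn_integral_eq_integral)
    show "integrable ?P (\<lambda>y. A + b * ?H y)" using int by simp
    have "0 \<le> best_approx_err N m l" unfolding best_approx_err_def by (intro sum_nonneg) auto
    then have "0 \<le> A" using q L0_pos c_pos by (simp add: A_def)
    then show "AE y in ?P. 0 \<le> A + b * ?H y" using b by (simp add: hellinger2_nonneg)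
  qed
  also have "(\<integral>y. A + b * ?H y \<partial>?P) = A + b * (\<integral>y. ?H y \<partial>?P)"
    using int by (simp add: measure_pmf.prob_space)
  also have "ennreal (A + b * (\<integral>y. ?H y \<partial>?P)) \<le>
      ennreal (5 * (sqrt W * (L0 * (2 + c * real M) + 1 / 2) + c * L0 * real M) + 3 * best_approx_err N m l)"
  proof (rule ennreal_leI)
    have "b * (\<integral>y. ?H y \<partial>?P) \<le> b * (scale * W)" using E_H b by (rule mult_left_mono)
    also have "\<dots> = 5 * (q / 2)"
    proof -
      have "W = q * q" using W by (simp add: q_def)
      then show ?thesis using scale_pos q by (simp add: b_def)
    qed
    finally show "A + b * (\<integral>y. ?H y \<partial>?P) \<le>
        5 * (sqrt W * (L0 * (2 + c * real M) + 1 / 2) + c * L0 * real M) + 3 * best_approx_err N m l"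
      by (simp add: A_def q_def algebra_simps)
  qed
  finally show ?thesis unfolding truth_eq .
qed

lemma risk_le_trivial:
  assumes l: "l \<in> nonneg_vecs N" "norm1 N l \<le> L0"
  shows "(\<integral>\<^sup>+ y. ennreal (norm1 N (\<lambda>i. est y i - l i)) \<partial>measure_pmf P) \<le> ennreal (2 * L0)"
proof -
  have "norm1 N (\<lambda>i. est y i - l i) \<le> 2 * L0" for y
  proof -
    have "norm1 N (\<lambda>i. est y i - l i) \<le> norm1 N (est y) + norm1 N l"
      using norm1_triangle_scaled[of N 1 "est y" "- 1" l] by simp
    then show ?thesis using quantized_classD(2)[OF est_class[of y]] l by simp
  qed
  then have "(\<integral>\<^sup>+ y. ennreal (norm1 N (\<lambda>i. est y i - l i)) \<partial>measure_pmf P) \<le> (\<integral>\<^sup>+ y. ennreal (2 * L0) \<partial>measure_pmf P)"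
    by (intro nn_integral_mono ennreal_leI)
  then show ?thesis by (simp add: measure_pmf.emeasure_space_1)
qed

end

section \<open>Choice of the sparsity and collection of the constants\<close>

text \<open>The level \<open>X\<close> equates the squared tail
  \<open>X powr (- 2 * \<alpha>)\<close> with the penalty \<open>X * \<rho>\<close>. Rounding up
  costs a factor 2 because \<open>X \<ge> 1\<close>. If the level is cut off at \<open>N\<close>, no
  tail bound is claimed, since nothing remains outside \<open>N\<close> coordinates.\<close>

lemma balanced_sparsity:
  fixes \<rho> \<alpha> :: real
  assumes \<rho>: "0 < \<rho>" "\<rho> < 1" and \<alpha>: "\<alpha> \<ge> 1" and N: "1 \<le> N"
  obtains m where "1 \<le> m" "m \<le> N" "m = N \<or> real m powr (- \<alpha>) \<le> \<rho> powr (\<alpha> / (2 * \<alpha> + 1))"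
    "real m * \<rho> \<le> 2 * (\<rho> powr (\<alpha> / (2 * \<alpha> + 1)))\<^sup>2"
proof -
  define X where "X = \<rho> powr (- 1 / (2 * \<alpha> + 1))"
  have X: "1 \<le> X"
    using powr_mono'[of "- 1 / (2 * \<alpha> + 1)" 0 \<rho>] \<rho> \<alpha> by (simp add: X_def)
  define m0 where "m0 = nat \<lceil>X\<rceil>"
  have m0: "X \<le> real m0" "real m0 \<le> 2 * X" unfolding m0_def using X by linarith+
  have w: "(\<rho> powr (\<alpha> / (2 * \<alpha> + 1)))\<^sup>2 = X * \<rho>"
  proof -
    have "(\<rho> powr (\<alpha> / (2 * \<alpha> + 1)))\<^sup>2 = \<rho> powr (2 * \<alpha> / (2 * \<alpha> + 1))"
      by (simp add: power2_eq_square flip: powr_add)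
    also have "2 * \<alpha> / (2 * \<alpha> + 1) = - 1 / (2 * \<alpha> + 1) + 1" using \<alpha> by (simp add: field_simps)
    also have "\<rho> powr (- 1 / (2 * \<alpha> + 1) + 1) = X * \<rho>"
      unfolding X_def powr_add using \<rho> by simp
    finally show ?thesis .
  qed
  have "real m0 powr (- \<alpha>) \<le> X powr (- \<alpha>)"
    using m0 X \<alpha> by (intro powr_mono2') auto
  also have "\<dots> = \<rho> powr (\<alpha> / (2 * \<alpha> + 1))" by (simp add: X_def powr_powr)
  finally have approx: "real m0 powr (- \<alpha>) \<le> \<rho> powr (\<alpha> / (2 * \<alpha> + 1))" .
  have "real (min m0 N) * \<rho> \<le> 2 * X * \<rho>" using m0 \<rho> by (intro mult_right_mono) auto
  moreover have "1 \<le> min m0 N" using m0 X N by simp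
  ultimately show ?thesis using that[of "min m0 N"] approx w by (auto simp: min_def)
qed

text \<open>The summands of \<open>C\<close> serve the degenerate cases, the tail term, the shift
  and the statistical error, in this order.\<close>

lemma pmle_risk_bound:
  fixes \<alpha> L0 K T \<delta> \<gamma> :: real and N k M d :: nat and l :: "nat \<Rightarrow> real"
  defines "a \<equiv> ln (real N / real k)" and "\<rho> \<equiv> ln (1 / \<delta>) / T" and "D \<equiv> L0 * (2 + K) + 1 / 2"
  assumes exp: "counting_experiment k N M d E \<Omega> T L0 \<delta> (\<gamma> / (real k * a)) pen est"
    and \<alpha>: "\<alpha> \<ge> 1" and K: "K > 0" and k: "1 \<le> k" "real k \<le> real N / 2"
    and M: "real M \<le> K * (real k * a)" and \<gamma>: "\<gamma> > 0" "\<gamma> / (real k * a) < 1"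
    and \<delta>: "0 < \<delta>" "\<delta> < 1" "L0 / sqrt \<delta> \<in> \<nat>"
    and pen: "\<And>r. r \<in> quantized_class N L0 \<delta> \<Longrightarrow> r \<noteq> (\<lambda>_. 0) \<Longrightarrow> pen r \<le> K * (real (norm0 N r) * ln (1 / \<delta>))"
    and quant: "\<And>m. m \<in> {1..N} \<Longrightarrow> real m * \<delta> \<le> K * (real m * \<rho>)"
    and l: "l \<in> heavy_tail N \<alpha> L0"
    and C: "C = 4 * L0 + 3 * L0 * 3 powr \<alpha> + 10 * (D * sqrt (2 * K * L0) + K * L0)
      + 10 * D * sqrt (4 * L0 + 48 * K / L0 + 4 * K)"
  shows "(\<integral>\<^sup>+ y. ennreal (norm1 N (\<lambda>i. est y i - l i)) \<partial>measure_pmf (poisson_law M (\<lambda>j. T * mat_app N (adj_matrix E) l j)))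
    \<le> ennreal (C * real k powr (- \<alpha>) + C * ln (real N) * sqrt (\<gamma> * real k)
      + C * ln (real N) * (sqrt (real k / \<gamma>) * \<rho> powr (\<alpha> / (2 * \<alpha> + 1))))" (is "?E \<le> ennreal ?R")
proof -
  interpret counting_experiment k N M d E \<Omega> T L0 \<delta> "\<gamma> / (real k * a)" pen est by (rule exp)
  define c where "c = \<gamma> / (real k * a)"
  define \<beta> where "\<beta> = \<alpha> / (2 * \<alpha> + 1)"
  have L0: "L0 > 0" and T: "T > 0" by (rule L0_pos, rule T_pos)
  have k0: "real k > 0" "2 * real k \<le> real N" using k by auto
  then have N2: "2 \<le> real N" using k(1) by linarith
  have a: "1 / 2 \<le> a" "a \<le> ln (real N)"
  proof -
    have "ln 2 \<le> a" unfolding a_def using k0 by (subst ln_le_cancel_iff) (auto simp: field_simps)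
    then show "1 / 2 \<le> a" using ln2_ge_two_thirds by linarith
    show "a \<le> ln (real N)" unfolding a_def using k0 N2 k(1) by (subst ln_le_cancel_iff) (auto simp: field_simps)
  qed
  then have lnN: "1 / 2 \<le> ln (real N)" by linarith
  \<comment> \<open>Since \<open>ln N \<ge> 1 / 2\<close>, the root of the logarithm in
    \<open>c\<close> is absorbed by one power of \<open>ln N\<close>.\<close>
  have sqrt_a: "sqrt a \<le> 2 * ln (real N)"
  proof (rule real_le_lsqrt)
    show "0 \<le> 2 * ln (real N)" using lnN by simp
    have "a * 1 \<le> ln (real N) * (4 * ln (real N))" using a lnN by (intro mult_mono) auto
    then show "a \<le> (2 * ln (real N))\<^sup>2" by (simp add: power2_eq_square)
  qed
  have l': "l \<in> nonneg_vecs N" "norm1 N l \<le> L0"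
    and tail: "\<And>m. m \<in> {1..N} \<Longrightarrow> best_approx_err N m l \<le> L0 * real m powr (- \<alpha>)"
    using l by (auto simp: heavy_tail_def)
  have D: "D > 0" using L0 K by (simp add: D_def add_pos_pos)
  define C1 C2 C3 where "C1 = 3 * L0 * 3 powr \<alpha>" and "C2 = 10 * (D * sqrt (2 * K * L0) + K * L0)"
    and "C3 = 10 * D * sqrt (4 * L0 + 48 * K / L0 + 4 * K)"
  have C_nonneg: "0 \<le> C1" "0 \<le> C2" "0 \<le> C3" using L0 K D by (auto simp: C1_def C2_def C3_def)
  have C': "C = 4 * L0 + C1 + C2 + C3" by (simp add: C C1_def C2_def C3_def)
  have C_pos: "C \<ge> 4 * L0" using C_nonneg C' by simp
  have \<rho>: "\<rho> > 0" unfolding \<rho>_def using \<delta> T by (intro divide_pos_pos) auto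
  define t1 t2 t3 where "t1 = real k powr (- \<alpha>)" and "t2 = ln (real N) * sqrt (\<gamma> * real k)"
    and "t3 = ln (real N) * (sqrt (real k / \<gamma>) * \<rho> powr \<beta>)"
  have t_nonneg: "0 \<le> t1" "0 \<le> t2" "0 \<le> t3"
    unfolding t1_def t2_def t3_def using lnN \<gamma> k0 by (auto intro!: mult_nonneg_nonneg)
  have R: "?R = C * t1 + C * t2 + C * t3" by (simp add: t1_def t2_def t3_def \<beta>_def)
  have R_ge: "C1 * t1 + C2 * t2 + C3 * t3 \<le> ?R"
    unfolding R using C_nonneg t_nonneg L0 by (intro add_mono mult_right_mono) (auto simp: C')
  show ?thesis
  proof (cases "k = 1 \<or> \<gamma> \<ge> 1 \<or> \<rho> \<ge> 1")
    case True
    \<comment> \<open>In each degenerate case one of the three rates is at least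
      \<open>1 / 2\<close>, and \<open>C \<ge> 4 * L0\<close> lifts the bound above the trivial risk
      \<open>2 * L0\<close>.\<close>
    have "1 / 2 \<le> t1 + t2 + t3"
    proof -
      have b: "1 / 2 * 1 \<le> ln (real N) * x" if "1 \<le> x" for x using lnN that by (intro mult_mono) auto
      consider "k = 1" | "\<gamma> \<ge> 1" | "\<gamma> < 1" "\<rho> \<ge> 1" using True by linarith
      then show ?thesis
      proof cases
        case 1
        then have "t1 = 1" by (simp add: t1_def)
        then show ?thesis using t_nonneg by simp
      next
        case 2
        have "1 * 1 \<le> \<gamma> * real k" using 2 k by (intro mult_mono) auto
        then have "1 / 2 \<le> t2" unfolding t2_def using b[of "sqrt (\<gamma> * real k)"] by simp
        then show ?thesis using t_nonneg by simp
      next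
        case 3
        have "1 \<le> real k / \<gamma>" using 3 \<gamma> k by (simp add: field_simps)
        then have "1 \<le> sqrt (real k / \<gamma>)" by simp
        moreover have "1 \<le> \<rho> powr \<beta>" using 3 \<alpha> by (intro ge_one_powr_ge_zero) (auto simp: \<beta>_def)
        ultimately have "1 * 1 \<le> sqrt (real k / \<gamma>) * \<rho> powr \<beta>" by (intro mult_mono) auto
        then have "1 / 2 \<le> t3" unfolding t3_def using b by simp
        then show ?thesis using t_nonneg by simp
      qed
    qed
    then have "4 * L0 * (1 / 2) \<le> C * (t1 + t2 + t3)" using C_pos L0 by (intro mult_mono) auto
    then have "2 * L0 \<le> ?R" unfolding R by (simp add: distrib_left)
    then show ?thesis using risk_le_trivial[OF l'] by (meson ennreal_leI order_trans)
  next
    case False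
    then have k2: "2 \<le> k" and \<gamma>1: "\<gamma> < 1" and \<rho>1: "\<rho> < 1" using k by auto
    have c: "0 < c" "c < 1" using c_pos \<gamma> by (simp_all only: c_def)
    \<comment> \<open>The expander estimate needs \<open>2 * m \<le> k\<close>;
      \<open>k \<le> 3 * m\<close> loses only a constant in the tail.\<close>
    define m where "m = k div 2"
    have "k \<le> 3 * m" "m \<le> k" using k2 by (auto simp: m_def)
    then have "real k \<le> 3 * real m" by linarith
    then have m: "1 \<le> m" "2 * m \<le> k" "m \<le> N" "real k \<le> 3 * real m"
      using k2 k0 \<open>m \<le> k\<close> by (auto simp: m_def)
    obtain n where n: "1 \<le> n" "n \<le> N" "n = N \<or> real n powr (- \<alpha>) \<le> \<rho> powr \<beta>" "real n * \<rho> \<le> 2 * (\<rho> powr \<beta>)\<^sup>2"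
      using balanced_sparsity[OF \<rho> \<rho>1 \<alpha>, of N] N2 unfolding \<beta>_def by auto
    define w where "w = (\<rho> powr \<beta>)\<^sup>2"
    have w: "0 < w" using \<rho> by (simp add: w_def)
    have err: "(best_approx_err N n l)\<^sup>2 \<le> L0\<^sup>2 * w"
    proof -
      have "best_approx_err N n l \<le> L0 * \<rho> powr \<beta>"
      proof (cases "n = N")
        case True
        obtain S where S: "S \<subseteq> {..<N}" "card S = N" "best_approx_err N N l = (\<Sum>i\<in>{..<N} - S. \<bar>l i\<bar>)"
          using best_approx_err_positions[of N N] by blast
        then have "S = {..<N}" by (intro card_subset_eq) auto
        then show ?thesis using S(3) True L0 by simp
      next
        case False
        then have "L0 * real n powr (- \<alpha>) \<le> L0 * \<rho> powr \<beta>" using n(3) L0 by (intro mult_left_mono) auto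
        then show ?thesis using tail[of n] n by auto
      qed
      moreover have "0 \<le> best_approx_err N n l" unfolding best_approx_err_def by (intro sum_nonneg) auto
      ultimately have "(best_approx_err N n l)\<^sup>2 \<le> (L0 * \<rho> powr \<beta>)\<^sup>2" by (rule power_mono)
      then show ?thesis by (simp add: w_def power_mult_distrib)
    qed
    have quant_n: "real n * \<delta> \<le> 2 * K * w"
    proof -
      have "real n * \<delta> \<le> K * (real n * \<rho>)" using quant[of n] n by auto
      also have "\<dots> \<le> K * (2 * w)" using n(4) K by (intro mult_left_mono) (auto simp: w_def)
      finally show ?thesis by simp
    qed
    \<comment> \<open>The three summands come from the squared tail, the quantization and the
      penalty. The last one is enlarged by \<open>1 / c\<close>, which exceeds 1.\<close>
    define C4 where "C4 = 4 * L0 + 48 * K / L0 + 4 * K"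
    have C4: "0 < C4" using L0 K by (simp add: C4_def add_pos_pos)
    define W where "W = C4 * (w / c) + 2 * K * L0 * \<gamma>"
    have W: "W > 0" using C4 w c K L0 \<gamma> by (simp add: W_def add_pos_pos)
    \<comment> \<open>The bound on \<open>M\<close> has the same factor \<open>k * a\<close> as the
      denominator of \<open>c\<close>.\<close>
    have cM: "c * real M \<le> K * \<gamma>"
    proof -
      have "c * real M \<le> c * (K * (real k * a))" using M c by (intro mult_left_mono) auto
      also have "\<dots> = K * \<gamma>" using k0 a by (simp add: c_def)
      finally show ?thesis .
    qed
    have W_ge: "2 / (c * L0) * (2 * (best_approx_err N n l)\<^sup>2 + 12 * real n * \<delta>) + 2 * c * L0 * real M
        + 2 * (K * ln (1 / \<delta>)) * real n / T \<le> W"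
    proof -
      have "2 / (c * L0) * (2 * (best_approx_err N n l)\<^sup>2 + 12 * real n * \<delta>) \<le>
          2 / (c * L0) * (2 * (L0\<^sup>2 * w) + 12 * (2 * K * w))"
        using err quant_n c L0 by (intro mult_left_mono) auto
      also have "\<dots> = (4 * L0 + 48 * K / L0) * (w / c)"
        using c L0 by (simp add: field_simps power2_eq_square)
      finally have 1: "2 / (c * L0) * (2 * (best_approx_err N n l)\<^sup>2 + 12 * real n * \<delta>) \<le> (4 * L0 + 48 * K / L0) * (w / c)" .
      have "2 * c * L0 * real M = 2 * L0 * (c * real M)" by simp
      also have "\<dots> \<le> 2 * L0 * (K * \<gamma>)" using cM L0 by (intro mult_left_mono) auto
      finally have 2: "2 * c * L0 * real M \<le> 2 * K * L0 * \<gamma>" by (simp add: mult_ac)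
      have "2 * (K * ln (1 / \<delta>)) * real n / T = 2 * K * (real n * \<rho>)" by (simp add: \<rho>_def)
      also have "\<dots> \<le> 2 * K * (2 * w)" using n(4) K by (intro mult_left_mono) (auto simp: w_def)
      also have "\<dots> \<le> 4 * K * (w / c)" using K w c by (simp add: field_simps)
      finally have 3: "2 * (K * ln (1 / \<delta>)) * real n / T \<le> 4 * K * (w / c)" .
      have "W = (4 * L0 + 48 * K / L0) * (w / c) + 2 * K * L0 * \<gamma> + 4 * K * (w / c)"
        unfolding W_def C4_def by (simp only: distrib_right add_ac)
      then show ?thesis using add_mono[OF add_mono[OF 1 2] 3] by simp
    qed
    have pen': "pen r \<le> K * ln (1 / \<delta>) * real (norm0 N r)" if "r \<in> quantized_class N L0 \<delta>" "r \<noteq> (\<lambda>_. 0)" for r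
      using pen[OF that] by (simp add: mult_ac)
    have Q: "0 \<le> K * ln (1 / \<delta>)" using K \<delta> by simp
    have "?E \<le> ennreal (5 * (sqrt W * (L0 * (2 + c * real M) + 1 / 2) + c * L0 * real M) + 3 * best_approx_err N m l)"
      using risk_le[OF m(1-3) l' \<delta>(1,3) n(1,2) pen' Q W W_ge[unfolded c_def]] unfolding c_def by simp
    also have "\<dots> \<le> ennreal ?R"
    proof (rule ennreal_leI)
      have sqrt_W: "sqrt W \<le> sqrt C4 * (2 * t3) + sqrt (2 * K * L0) * (2 * t2)"
      proof -
        have "sqrt W \<le> sqrt (C4 * (w / c)) + sqrt (2 * K * L0 * \<gamma>)"
          unfolding W_def using C4 w c K L0 \<gamma> by (intro sqrt_add_le_add_sqrt) auto
        also have "\<dots> = sqrt C4 * sqrt (w / c) + sqrt (2 * K * L0) * sqrt \<gamma>"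
          by (simp only: real_sqrt_mult)
        \<comment> \<open>Division by \<open>c\<close> produces the factor
          \<open>sqrt (k / \<gamma>)\<close> of the third rate together with
          \<open>sqrt a\<close>.\<close>
        also have "sqrt (w / c) = sqrt a * (sqrt (real k / \<gamma>) * \<rho> powr \<beta>)"
          unfolding w_def c_def by (simp add: real_sqrt_divide real_sqrt_mult)
        also have "\<dots> \<le> 2 * ln (real N) * (sqrt (real k / \<gamma>) * \<rho> powr \<beta>)"
          using sqrt_a \<gamma> by (intro mult_right_mono) auto
        also have "\<dots> = 2 * t3" by (simp add: t3_def)
        also have "sqrt \<gamma> \<le> 2 * t2"
        proof -
          have "1 * sqrt \<gamma> \<le> (2 * ln (real N)) * sqrt (\<gamma> * real k)"
            using lnN \<gamma> k by (intro mult_mono) (auto simp: mult_le_cancel_left1)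
          then show ?thesis by (simp add: t2_def)
        qed
        finally show ?thesis using C4 K L0 by (simp add: mult_left_mono)
      qed
      have \<gamma>_le: "\<gamma> \<le> 2 * t2"
      proof -
        have "\<gamma> \<le> sqrt (\<gamma> * real k)"
        proof (rule real_le_rsqrt)
          have "\<gamma> * \<gamma> \<le> \<gamma> * real k" using \<gamma> \<gamma>1 k by (intro mult_left_mono) auto
          then show "\<gamma>\<^sup>2 \<le> \<gamma> * real k" by (simp add: power2_eq_square)
        qed
        then have "1 * \<gamma> \<le> (2 * ln (real N)) * sqrt (\<gamma> * real k)" using lnN \<gamma> by (intro mult_mono) auto
        then show ?thesis by (simp add: t2_def)
      qed
      have "c * real M \<le> K" using cM \<gamma>1 K by (smt (verit) mult_less_cancel_left2)
      then have "L0 * (2 + c * real M) + 1 / 2 \<le> D" using L0 by (simp add: D_def)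
      then have "sqrt W * (L0 * (2 + c * real M) + 1 / 2) \<le> (sqrt C4 * (2 * t3) + sqrt (2 * K * L0) * (2 * t2)) * D"
        using sqrt_W c L0 C4 t_nonneg K by (intro mult_mono) auto
      moreover have "c * L0 * real M \<le> K * L0 * (2 * t2)"
      proof -
        have "c * L0 * real M = L0 * (c * real M)" by simp
        also have "\<dots> \<le> L0 * (K * (2 * t2))"
          using cM \<gamma>_le K L0 by (intro mult_left_mono order_trans[OF cM] mult_left_mono) auto
        finally show ?thesis by (simp add: mult_ac)
      qed
      moreover have "3 * best_approx_err N m l \<le> C1 * t1"
      proof -
        have "real m powr (- \<alpha>) \<le> (real k / 3) powr (- \<alpha>)"
          using m k0 \<alpha> by (intro powr_mono2') auto
        also have "\<dots> = 3 powr \<alpha> * t1"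
          using k0 by (simp add: t1_def powr_divide powr_minus field_simps)
        finally have "L0 * real m powr (- \<alpha>) \<le> L0 * (3 powr \<alpha> * t1)" using L0 by (intro mult_left_mono) auto
        then show ?thesis using tail[of m] m by (simp add: C1_def)
      qed
      ultimately have "5 * (sqrt W * (L0 * (2 + c * real M) + 1 / 2) + c * L0 * real M) + 3 * best_approx_err N m l \<le>
          5 * ((sqrt C4 * (2 * t3) + sqrt (2 * K * L0) * (2 * t2)) * D + K * L0 * (2 * t2)) + C1 * t1"
        by (intro add_mono mult_left_mono) simp_all
      also have "\<dots> = C1 * t1 + C2 * t2 + C3 * t3"
        by (simp add: C2_def C3_def C4_def algebra_simps)
      also note R_ge
      finally show "5 * (sqrt W * (L0 * (2 + c * real M) + 1 / 2) + c * L0 * real M) + 3 * best_approx_err N m l \<le> ?R" .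
    qed
    finally show ?thesis .
  qed
qed

text \<open>All implied constants of the hypotheses are bundled in \<open>K\<close>, and the hidden
  logarithms are a power \<open>p\<close> of \<open>ln N\<close>. The expected loss is an extended
  nonnegative integral, so its supremum exists in \<open>ennreal\<close>. The penalty is compared
  with sparsity at nonzero vectors: at zero the comparison would force penalty 0, and the Kraft sum
  would exceed 1 as soon as the class has another element.\<close>

theorem theorem6:
  fixes \<alpha> L0 K :: real
  assumes "\<alpha> \<ge> 1" and "L0 > 0" and "K > 0"
  shows "\<exists>(C::real) (p::nat). C > 0 \<and>
    (\<forall>(N::nat) (k::nat) (M::nat) (d::nat) (E :: (nat \<times> nat) set) (\<Omega> :: nat set)
      (n::nat) (\<tau>::real) (\<delta>::real) (\<gamma>::real) (c::real)
      (\<Lambda> :: (nat \<Rightarrow> real) set) (pen :: (nat \<Rightarrow> real) \<Rightarrow> real)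
      (est :: (nat \<Rightarrow> nat) \<Rightarrow> nat \<Rightarrow> real).
        1 \<le> k \<and> real k \<le> real N / 2 \<and> \<tau> > 0 \<and> n \<ge> 1 \<and>
        expander k (1/16) N M d E \<and> d \<ge> 1 \<and>
        real d \<le> K * ln (real N / real k) \<and>
        real M \<le> K * (real k * ln (real N / real k)) \<and>
        covering_set N M E \<Omega> \<and>
        0 < \<delta> \<and> \<delta> < 1 \<and> L0 / sqrt \<delta> \<in> \<nat> \<and>
        \<Lambda> = quantized_class N L0 \<delta> \<and>
        (\<forall>l\<in>\<Lambda>. l \<noteq> (\<lambda>_. 0) \<longrightarrow> eq_upto K (pen l) (real (norm0 N l) * ln (1 / \<delta>))) \<and>
        (\<Sum>l\<in>\<Lambda>. exp (- pen l)) \<le> 1 \<and>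
        (\<forall>l\<in>heavy_tail N \<alpha> L0. \<forall>m\<in>{1..N}. \<exists>l'\<in>\<Lambda>.
           eq_upto K (real (norm0 N l')) (real m) \<and>
           eq_upto K ((norm1 N (\<lambda>i. l i - l' i))\<^sup>2) (real m powr (-2 * \<alpha>) + real m * \<delta>)) \<and>
        (\<forall>m\<in>{1..N}. real m * \<delta> \<le> K * (real m * ln (1 / \<delta>) / (real n * \<tau>))) \<and>
        \<gamma> > 0 \<and> c = \<gamma> / (real k * ln (real N / real k)) \<and> c < 1 \<and>
        is_pmle N M d E \<Omega> n \<tau> L0 c \<Lambda> pen est
      \<longrightarrow>
        (SUP l\<in>heavy_tail N \<alpha> L0.
           \<integral>\<^sup>+ y. ennreal (norm1 N (\<lambda>i. est y i - l i))
             \<partial>measure_pmf (poisson_law M (\<lambda>j. real n * \<tau> * mat_app N (adj_matrix E) l j)))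
        \<le> ennreal (C * real k powr (-\<alpha>)
             + C * ln (real N) ^ p * sqrt (\<gamma> * real k)
             + C * ln (real N) ^ p * (sqrt (real k / \<gamma>)
                 * (ln (1 / \<delta>) / (real n * \<tau>)) powr (\<alpha> / (2 * \<alpha> + 1)))))"
proof -
  define D where "D = L0 * (2 + K) + 1 / 2"
  define C where "C = 4 * L0 + 3 * L0 * 3 powr \<alpha> + 10 * (D * sqrt (2 * K * L0) + K * L0)
      + 10 * D * sqrt (4 * L0 + 48 * K / L0 + 4 * K)"
  have "D > 0" using assms by (simp add: D_def add_pos_pos)
  then have "C > 0" using assms by (auto simp: C_def intro!: add_pos_nonneg)
  show ?thesis
  proof (rule exI[of _ C], rule exI[of _ 1], intro conjI allI impI SUP_least; (elim conjE)?)
    show "C > 0" by fact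
  next
    fix N k M d :: nat and E :: "(nat \<times> nat) set" and \<Omega> :: "nat set" and n :: nat and \<tau> \<delta> \<gamma> c :: real
      and \<Lambda> :: "(nat \<Rightarrow> real) set" and pen :: "(nat \<Rightarrow> real) \<Rightarrow> real"
      and est :: "(nat \<Rightarrow> nat) \<Rightarrow> nat \<Rightarrow> real" and l :: "nat \<Rightarrow> real"
    assume k: "1 \<le> k" "real k \<le> real N / 2" and \<tau>: "\<tau> > 0" and n: "n \<ge> 1"
      and E: "expander k (1/16) N M d E" "d \<ge> 1"
      and M: "real M \<le> K * (real k * ln (real N / real k))"
      and \<Omega>: "covering_set N M E \<Omega>"
      and \<delta>: "0 < \<delta>" "\<delta> < 1" "L0 / sqrt \<delta> \<in> \<nat>"
      and \<Lambda>: "\<Lambda> = quantized_class N L0 \<delta>"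
      and pen: "\<forall>l\<in>\<Lambda>. l \<noteq> (\<lambda>_. 0) \<longrightarrow> eq_upto K (pen l) (real (norm0 N l) * ln (1 / \<delta>))"
      and kraft: "(\<Sum>l\<in>\<Lambda>. exp (- pen l)) \<le> 1"
      and quant: "\<forall>m\<in>{1..N}. real m * \<delta> \<le> K * (real m * ln (1 / \<delta>) / (real n * \<tau>))"
      and \<gamma>: "\<gamma> > 0" and c: "c = \<gamma> / (real k * ln (real N / real k))" "c < 1"
      and pmle: "is_pmle N M d E \<Omega> n \<tau> L0 c \<Lambda> pen est"
      and l: "l \<in> heavy_tail N \<alpha> L0"
    \<comment> \<open>The bound \<open>k \<le> N / 2\<close> gives
      \<open>N / k \<ge> 2\<close>.\<close>
    have "ln (real N / real k) > 0" using k by (intro ln_gt_zero) (auto simp: field_simps)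
    then have c_pos: "c > 0" using c \<gamma> k by simp
    have graph: "expander_graph k (1 / 16) N M d E" using E by unfold_locales
    have exper: "counting_experiment k N M d E \<Omega> (real n * \<tau>) L0 \<delta> c pen est"
    proof (intro counting_experiment.intro counting_experiment_axioms.intro graph)
      show "covering_set N M E \<Omega>" by fact
      show "real n * \<tau> > 0" using n \<tau> by simp
      show "(\<Sum>l\<in>quantized_class N L0 \<delta>. exp (- pen l)) \<le> 1" using kraft \<Lambda> by simp
      show "\<exists>f. is_arg_min
        (\<lambda>f. - ln (poisson_lik M (mat_app N (expander_graph.\<Phi> d E) f) y)
          + 2 * pen (unshift (real n * \<tau> * real d) (c * (real n * \<tau> * real d * L0)) \<Omega> f))
        (\<lambda>f. f \<in> shifted_class (real n * \<tau> * real d) (c * (real n * \<tau> * real d * L0)) \<Omega> (quantized_class N L0 \<delta>)) f \<and>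
        est y = unshift (real n * \<tau> * real d) (c * (real n * \<tau> * real d * L0)) \<Omega> f" for y
        using pmle unfolding is_pmle_def Let_def \<Lambda> expander_graph.\<Phi>_def[OF graph, abs_def] by blast
    qed (use assms(2) c_pos in auto)
    show "(\<integral>\<^sup>+ y. ennreal (norm1 N (\<lambda>i. est y i - l i))
             \<partial>measure_pmf (poisson_law M (\<lambda>j. real n * \<tau> * mat_app N (adj_matrix E) l j)))
        \<le> ennreal (C * real k powr (-\<alpha>)
             + C * ln (real N) ^ 1 * sqrt (\<gamma> * real k)
             + C * ln (real N) ^ 1 * (sqrt (real k / \<gamma>)
                 * (ln (1 / \<delta>) / (real n * \<tau>)) powr (\<alpha> / (2 * \<alpha> + 1))))"
      unfolding power_one_right
    proof (rule pmle_risk_bound[OF exper[unfolded c(1)] assms(1,3) k M \<gamma> c(2)[unfolded c(1)] \<delta> _ _ l C_def[unfolded D_def]])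
      show "pen r \<le> K * (real (norm0 N r) * ln (1 / \<delta>))" if "r \<in> quantized_class N L0 \<delta>" "r \<noteq> (\<lambda>_. 0)" for r
        using pen that by (auto simp: \<Lambda> eq_upto_def)
      show "real m * \<delta> \<le> K * (real m * (ln (1 / \<delta>) / (real n * \<tau>)))" if "m \<in> {1..N}" for m
        using quant that by auto
    qed
  qed
qed

end
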